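(* Let $k$ be a positive integer and let $D$ be an acyclic digraph with a single vertex of in-degree zero. Then either $\ell_s(D)\ge k$, or the underlying undirected graph $\mathrm{UG}(D)$ has pathwidth at most $4k$ and a path decomposition of $\mathrm{UG}(D)$ of width at most $4k$ can be obtained in polynomial time. Here $\ell_s(D)$ denotes the maximum number of leaves in an out-branching of $D$.
   Context: Digraphs are finite, without loops and without parallel arcs. A digraph is acyclic if it has no directed cycle. The underlying graph $\mathrm{UG}(D)$ is obtained from $D$ by omitting all orientations of arcs and deleting one edge from each resulting pair of parallel edges. A subdigraph $T$ of $D$ is an out-tree if $T$ is an oriented tree (its underlying undirected graph is a tree) with exactly one vertex of in-degree zero in $T$, called the root. An out-branching of $D$ is an out-tree $T$ in $D$ with $V(T)=V(D)$. The leaves of $T$ are the vertices of out-degree zero in $T$. $\ell_s(D)$ is the maximum number of leaves in an out-branching of $D$ (and $\ell_s(D)=0$ if $D$ has no out-branching). A path decomposition of an undirected graph $G$ is a sequence $(X_1,\dots,X_m)$ of subsets of $V(G)$ (bags) whose union is $V(G)$, such that every edge of $G$ has both ends in some $X_i$, and for each $v\in V(G)$ the indices $i$ with $v\in X_i$ are consecutive; its width is $\max_i |X_i|-1$, and the pathwidth of $G$ is the minimum width of a path decomposition of $G$. *)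

theory Defs
  imports "Graph_Theory.Graph_Theory" "HOL-Computational_Algebra.Polynomial"
begin

section \<open>Digraphs, out-branchings and leaves\<close>

text \<open>
  The locale \<^locale>\<open>digraph\<close> is that of finite digraphs without loops and without
  parallel arcs (arcs of opposite direction are allowed). Undirected graphs are represented, as
  usual in this library, by symmetric digraphs.
\<close>

abbreviation UG :: "('a,'b) pre_digraph \<Rightarrow> ('a, 'a \<times> 'a) pre_digraph" where
  "UG D \<equiv> with_proj (mk_symmetric D)"

definition acyclic_digraph :: "('a,'b) pre_digraph \<Rightarrow> bool" where
  "acyclic_digraph D \<longleftrightarrow> \<not> (\<exists>p. pre_digraph.cycle D p)"

text \<open>
  The library predicate \<^const>\<open>tree\<close> only excludes \<^emph>\<open>directed\<close> cycles, so it does not say that the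
  underlying undirected graph is a tree. In a symmetric digraph without loops the cycles of length
  at least 3 are exactly the cycles of the undirected graph (a single edge, traversed back and
  forth, is a directed cycle of length 2).
\<close>

definition undirected_tree :: "('a,'b) pre_digraph \<Rightarrow> bool" where
  "undirected_tree G \<longleftrightarrow>
     Digraph_Component.connected G \<and> \<not> (\<exists>p. pre_digraph.cycle G p \<and> 3 \<le> length p)"

definition oriented_tree :: "('a,'b) pre_digraph \<Rightarrow> bool" where
  "oriented_tree T \<longleftrightarrow> digraph T \<and>
     (\<forall>u v. (u, v) \<in> arcs_ends T \<longrightarrow> (v, u) \<notin> arcs_ends T) \<and> undirected_tree (UG T)"

definition out_tree :: "('a,'b) pre_digraph \<Rightarrow> bool" where
  "out_tree T \<longleftrightarrow> oriented_tree T \<and> (\<exists>!r. r \<in> verts T \<and> in_degree T r = 0)"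

definition out_branching :: "('a,'b) pre_digraph \<Rightarrow> ('a,'b) pre_digraph \<Rightarrow> bool" where
  "out_branching D T \<longleftrightarrow> spanning T D \<and> out_tree T"

definition leaves :: "('a,'b) pre_digraph \<Rightarrow> 'a set" where
  "leaves T = {v \<in> verts T. out_degree T v = 0}"

definition max_leaves :: "('a,'b) pre_digraph \<Rightarrow> nat" where
  "max_leaves D =
     (if \<exists>T. out_branching D T then Max {card (leaves T) | T. out_branching D T} else 0)"


section \<open>Pathwidth\<close>

definition path_decomposition :: "('a,'b) pre_digraph \<Rightarrow> 'a set list \<Rightarrow> bool" where
  "path_decomposition G Xs \<longleftrightarrow>
     Xs \<noteq> [] \<and>
     \<Union>(set Xs) = verts G \<and>
     (\<forall>u v. (u, v) \<in> arcs_ends G \<longrightarrow> (\<exists>X\<in>set Xs. u \<in> X \<and> v \<in> X)) \<and>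
     (\<forall>v h i j. h \<le> i \<and> i \<le> j \<and> j < length Xs \<and> v \<in> Xs ! h \<and> v \<in> Xs ! j \<longrightarrow> v \<in> Xs ! i)"

definition width :: "'a set list \<Rightarrow> int" where
  "width Xs = int (Max (card ` set Xs)) - 1"

text \<open>
  Widths are integers \<open>\<ge> -1\<close> and the decomposition with the single bag \<open>verts G\<close> always exists,
  so for a finite graph the infimum is a minimum.
\<close>

definition pathwidth :: "('a,'b) pre_digraph \<Rightarrow> int" where
  "pathwidth G = Inf {width Xs | Xs. path_decomposition G Xs}"


section \<open>Polynomial time\<close>

text \<open>
  Computations are those of a unit-cost random access machine, programmed in a structured
  language. The memory consists of named arrays of natural numbers (a program mentions only
  finitely many names; a scalar variable is cell 0 of an array), and the output goes to a
  write-only tape. Addition and truncated subtraction are the only arithmetic operations: without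
  multiplication, \<open>t\<close> steps can only produce numbers of bit length \<open>O(t)\<close> plus that of the
  input numbers, so unit cost is polynomially equivalent to Turing machine time.
\<close>

datatype expr =
    Lit nat
  | Load string expr
  | Add expr expr
  | Sub expr expr
  | Less expr expr
  | Equal expr expr

datatype com =
    SKIP
  | STORE string expr expr
  | EMIT expr
  | SEQ com com
  | IF expr com com
  | WHILE expr com

type_synonym memory = "string \<Rightarrow> nat \<Rightarrow> nat"

primrec eval :: "memory \<Rightarrow> expr \<Rightarrow> nat" where
  "eval M (Lit n) = n"
| "eval M (Load x e) = M x (eval M e)"
| "eval M (Add e1 e2) = eval M e1 + eval M e2"
| "eval M (Sub e1 e2) = eval M e1 - eval M e2"
| "eval M (Less e1 e2) = (if eval M e1 < eval M e2 then 1 else 0)"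
| "eval M (Equal e1 e2) = (if eval M e1 = eval M e2 then 1 else 0)"

text \<open>
  \<open>exec c (M, out) t (M', out')\<close>: started with memory \<open>M\<close> and output \<open>out\<close>, the program \<open>c\<close> halts
  after exactly \<open>t\<close> steps with memory \<open>M'\<close> and output \<open>out'\<close>. Evaluating an expression is
  charged as one step; expressions have bounded size in a fixed program.
\<close>

inductive exec :: "com \<Rightarrow> memory \<times> nat list \<Rightarrow> nat \<Rightarrow> memory \<times> nat list \<Rightarrow> bool" where
  Skip: "exec SKIP s 1 s"
| Store: "exec (STORE x e1 e2) (M, out) 1 (M(x := (M x)(eval M e1 := eval M e2)), out)"
| Emit: "exec (EMIT e) (M, out) 1 (M, out @ [eval M e])"
| Seq: "exec c1 s1 t1 s2 \<Longrightarrow> exec c2 s2 t2 s3 \<Longrightarrow> exec (SEQ c1 c2) s1 (t1 + t2) s3"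
| IfTrue: "eval M e \<noteq> 0 \<Longrightarrow> exec c1 (M, out) t s \<Longrightarrow> exec (IF e c1 c2) (M, out) (t + 1) s"
| IfFalse: "eval M e = 0 \<Longrightarrow> exec c2 (M, out) t s \<Longrightarrow> exec (IF e c1 c2) (M, out) (t + 1) s"
| WhileFalse: "eval M e = 0 \<Longrightarrow> exec (WHILE e c) (M, out) 1 (M, out)"
| WhileTrue: "eval M e \<noteq> 0 \<Longrightarrow> exec c (M, out) t1 s2 \<Longrightarrow> exec (WHILE e c) s2 t2 s3 \<Longrightarrow>
    exec (WHILE e c) (M, out) (t1 + t2 + 1) s3"

text \<open>
  The input is the number \<open>k\<close> together with the number of vertices and the adjacency matrix
  (stored row by row) of \<open>D\<close>, with respect to an enumeration \<open>vs\<close> of the vertices.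
\<close>

definition input_memory :: "nat \<Rightarrow> ('a,'b) pre_digraph \<Rightarrow> 'a list \<Rightarrow> memory" where
  "input_memory k D vs = (\<lambda>x a.
     let n = length vs in
     if x = ''k'' \<and> a = 0 then k
     else if x = ''n'' \<and> a = 0 then n
     else if x = ''A'' \<and> a < n * n \<and> (vs ! (a div n), vs ! (a mod n)) \<in> arcs_ends D then 1
     else 0)"

text \<open>
  A sequence of bags is written out bag by bag: the elements of a bag as \<open>Suc i\<close>, where \<open>i\<close> is the
  position of the vertex in \<open>vs\<close>, followed by the terminator 0.
\<close>

definition encodes_bags :: "'a list \<Rightarrow> nat list \<Rightarrow> 'a set list \<Rightarrow> bool" where
  "encodes_bags vs out Xs \<longleftrightarrow>
     (\<exists>bs. out = concat (map (\<lambda>b. map Suc b @ [0]) bs) \<and>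
           (\<forall>b\<in>set bs. set b \<subseteq> {..<length vs}) \<and>
           Xs = map (\<lambda>b. (!) vs ` set b) bs)"

end

(*
Let s be the source. As D is acyclic, any choice of an in-neighbour for every vertex other than s
is an out-branching. Hence, if S meets the in-neighbourhood of every v other than s, the vertices
outside S are leaves of some out-branching, and L := |V - S| < k.

Take S inclusion-minimal. Then every p in S has a vertex F p whose only in-neighbour in S is p,
and F is injective on S. The set Z := (V - S) \<union> (V - F(S)) has at most 2 L elements, and an arc
(u, v) of D - Z has u in S and v = F p for some p, so u = p. Thus UG(D) - Z consists of the paths
that F traces out, and the bags Z \<union> {y, F y}, taken along these paths, have size at most 2 L + 2.

Only one pass over the vertices is needed to find S and F: a vertex with a private out-neighbour
at some stage of the elimination keeps it, because S only shrinks.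
*)
theory Submission
  imports Defs
begin

section \<open>Out-branchings of acyclic digraphs\<close>

text \<open>The program never looks at k and never computes the maximum number l of leaves: on every
  input its output has width at most 2 l + 1, which for l < k is at most 2 k - 1. The factor 2 comes
  from V - F(S) having as many elements as V - S. Acyclicity enters at two places. It makes every
  choice of one in-arc per vertex a tree, and it forbids closed orbits of F, so that the paths
  started outside F(S) exhaust the vertices. A vertex may leave S only if each of its out-neighbours
  keeps another in-neighbour in S; otherwise an out-neighbour that would be left without one is
  private to it. Membership in S and the map F share one array, in which the value n stands for
  absence from S and, at the same time, for the end of a path.\<close>

lemma acyclic_digraph_rank:
  fixes D :: "('a, 'b) pre_digraph"
  assumes "digraph D" "acyclic_digraph D"
  obtains r :: "'a \<Rightarrow> nat" where "\<And>u v. (u, v) \<in> arcs_ends D \<Longrightarrow> r u < r v"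
proof -
  interpret digraph D by fact
  have irrefl: "(v, v) \<notin> (arcs_ends D)\<^sup>+" for v
  proof
    assume "(v, v) \<in> (arcs_ends D)\<^sup>+"
    then obtain p where "awalk v p v" "p \<noteq> []"
      using reachable1_awalk by blast
    then have "closed_w p" by (auto simp: closed_w_def)
    then show False
      using assms(2) closed_w_imp_cycle by (auto simp: acyclic_digraph_def)
  qed
  \<comment> \<open>The rank of v counts its proper ancestors. Along an arc from u to v the
    ancestors of u are inherited, and u is a new one because it does not reach itself.\<close>
  define r where "r v = card {u. (u, v) \<in> (arcs_ends D)\<^sup>+}" for v
  have "r u < r v" if "(u, v) \<in> arcs_ends D" for u v
    unfolding r_def
  proof (rule psubset_card_mono)
    have "{w. (w, v) \<in> (arcs_ends D)\<^sup>+} \<subseteq> verts D"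
      using reachable1_in_verts by auto
    then show "finite {w. (w, v) \<in> (arcs_ends D)\<^sup>+}"
      by (rule finite_subset) simp
    show "{w. (w, u) \<in> (arcs_ends D)\<^sup>+} \<subset> {w. (w, v) \<in> (arcs_ends D)\<^sup>+}"
      using that irrefl[of u] by (auto intro: trancl_into_trancl)
  qed
  then show thesis by (rule that)
qed


section \<open>Trees given by one in-arc per vertex\<close>

lemma arcs_ends_UG: "arcs_ends (UG D) = symcl (arcs_ends D)"
  by (auto simp: parcs_mk_symmetric symcl_def arcs_ends_conv)

text \<open>A vertex of largest rank on an undirected cycle would have two distinct in-neighbours.\<close>

lemma no_undirected_cycle:
  fixes T :: "('a, 'b) pre_digraph" and r :: "'a \<Rightarrow> nat"
  assumes rank: "\<And>u v. (u, v) \<in> arcs_ends T \<Longrightarrow> r u < r v"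
    and inj: "\<And>u u' v. (u, v) \<in> arcs_ends T \<Longrightarrow> (u', v) \<in> arcs_ends T \<Longrightarrow> u = u'"
    and cyc: "pre_digraph.cycle (UG T) p"
  shows "length p < 3"
proof (rule ccontr)
  assume len: "\<not> length p < 3"
  \<comment> \<open>Arc number i of the cycle runs from \<open>w (prv i)\<close> to
    \<open>w i\<close>, with indices read cyclically; in \<open>T\<close> it may point either
    way.\<close>
  define m where "m = length p"
  define w where "w i = snd (p ! i)" for i
  define prv where "prv i = (if i = 0 then m - 1 else i - 1)" for i
  define nxt where "nxt i = (if i = m - 1 then 0 else Suc i)" for i
  from cyc obtain u where u: "pre_digraph.awalk (UG T) u p u" "p \<noteq> []"
     "distinct (tl (pre_digraph.awalk_verts (UG T) u p))"
    by (auto simp: pre_digraph.cycle_def)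
  have sub: "set p \<subseteq> symcl (arcs_ends T)" and cas: "pcas u p u"
    using u arcs_ends_UG[of T] by (auto simp: pre_digraph.awalk_def cas_with_proj_eq)
  have "tl (pre_digraph.awalk_verts (UG T) u p) = map snd p"
    using pre_digraph.awalk_verts_conv'[of "UG T" u p u] cas u(2)
    by (simp add: cas_with_proj_eq)
  then have dist: "distinct (map snd p)"
    using u(3) by simp
  have fst_p: "fst (p ! i) = (if i = 0 then u else snd (p ! (i - 1)))"
    if "pcas u p v" "i < length p" for u v p i
    using that by (induction p arbitrary: i u) (auto simp: nth_Cons')
  have last_p: "snd (last p) = v" if "pcas u p v" "p \<noteq> []" for u v and p :: "('a \<times> 'a) list"
    using that by (induction p arbitrary: u) auto
  have "w (m - 1) = u"
    using last_p[OF cas u(2)] u(2) by (simp add: w_def m_def last_conv_nth)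
  then have "p ! i = (w (prv i), w i)" if "i < m" for i
    using fst_p[OF cas, of i] that by (simp add: prod_eq_iff w_def prv_def m_def)
  then have arc: "(w (prv i), w i) \<in> arcs_ends T \<or> (w i, w (prv i)) \<in> arcs_ends T" if "i < m" for i
    using sub that unfolding m_def symcl_def by (fastforce dest: nth_mem)
  obtain i where i: "i < m" "\<And>j. j < m \<Longrightarrow> r (w j) \<le> r (w i)"
  proof -
    define A where "A = (\<lambda>j. r (w j)) ` {..<m}"
    have A: "finite A" "A \<noteq> {}"
      using u(2) by (auto simp: A_def m_def)
    obtain i where "i < m" "Max A = r (w i)"
      using Max_in[OF A] by (auto simp: A_def)
    then show thesis
      using that Max_ge[OF A(1)] by (auto simp: A_def)
  qed
  have bnd: "prv i < m" "nxt i < m" and prv_nxt: "prv (nxt i) = i"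
    using i len by (auto simp: prv_def nxt_def m_def)
  have "(w (prv i), w i) \<in> arcs_ends T"
    using arc[OF i(1)] rank i(2)[OF bnd(1)] by (meson not_le)
  moreover have "(w (nxt i), w i) \<in> arcs_ends T"
    using arc[OF bnd(2)] rank i(2)[OF bnd(2)] unfolding prv_nxt by (meson not_le)
  ultimately have "w (prv i) = w (nxt i)"
    by (rule inj)
  then have "prv i = nxt i"
    using dist bnd unfolding w_def m_def by (auto simp: distinct_conv_nth)
  \<comment> \<open>The cyclic predecessor and successor of an index coincide only if m \<le> 2.
    This is where the length bound enters.\<close>
  then show False
    using i(1) len by (auto simp: prv_def nxt_def m_def split: if_splits)
qed

text \<open>Connectedness is strong connectedness of the symmetric closure, so \<open>UG T\<close>
  gets symmetrised a second time. Reachability lifts through both layers, and in the inner one a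
  path from \<open>s\<close> can be reversed, which joins any two vertices through
  \<open>s\<close>.\<close>

lemma connected_UG:
  assumes "wf_digraph T" "s \<in> verts T" "\<And>v. v \<in> verts T \<Longrightarrow> s \<rightarrow>\<^sup>*\<^bsub>T\<^esub> v"
  shows "Digraph_Component.connected (UG T)"
proof -
  interpret T: wf_digraph T by fact
  interpret U: pair_wf_digraph "mk_symmetric T" by (rule T.wellformed_mk_symmetric)
  have from_s: "s \<rightarrow>\<^sup>*\<^bsub>mk_symmetric T\<^esub> v" if "v \<in> verts T" for v
    using assms(3)[OF that] by (rule T.reachable_mk_symmetricI)
  have "u \<rightarrow>\<^sup>*\<^bsub>mk_symmetric (UG T)\<^esub> v" if "u \<in> verts T" "v \<in> verts T" for u v
  proof (rule U.reachable_mk_symmetricI)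
    have "u \<rightarrow>\<^sup>*\<^bsub>mk_symmetric T\<^esub> s"
      by (rule symmetric_reachable[OF symmetric_mk_symmetric from_s[OF that(1)]])
    then show "u \<rightarrow>\<^sup>*\<^bsub>mk_symmetric T\<^esub> v"
      using from_s[OF that(2)] by (rule U.reachable_trans)
  qed
  then show ?thesis
    using assms(2) unfolding connected_def by (intro strongly_connectedI) auto
qed

lemma card_le_max_leaves:
  assumes "fin_digraph D" "out_branching D T"
  shows "card (leaves T) \<le> max_leaves D"
proof -
  have fin: "finite (verts D)"
    using assms(1) by (rule fin_digraph.finite_verts)
  have "card (leaves T') \<le> card (verts D)" if "out_branching D T'" for T'
    using that by (intro card_mono fin) (auto simp: out_branching_def spanning_def leaves_def)
  then have "finite {card (leaves T) | T. out_branching D T}"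
    unfolding finite_nat_set_iff_bounded_le by blast
  then show ?thesis
    using assms(2) unfolding max_leaves_def by (auto intro!: Max_ge)
qed

text \<open>Since ranks decrease along the chosen in-arcs read backwards, every vertex is led back
  to \<open>s\<close>; having one in-arc each, the vertices carry no undirected cycle. All tails of
  \<open>T\<close> lie in \<open>S\<close>, so the remaining vertices are leaves.\<close>

lemma card_diff_dominating_le_max_leaves:
  fixes D :: "('a, 'b) pre_digraph"
  assumes D: "digraph D" "acyclic_digraph D"
    and s: "s \<in> verts D" "in_degree D s = 0"
    and dom: "\<And>v. v \<in> verts D \<Longrightarrow> v \<noteq> s \<Longrightarrow> \<exists>u\<in>S. (u, v) \<in> arcs_ends D"
  shows "card (verts D - S) \<le> max_leaves D"
proof -
  interpret digraph D by fact
  obtain r :: "'a \<Rightarrow> nat" where r: "\<And>u v. (u, v) \<in> arcs_ends D \<Longrightarrow> r u < r v"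
    using acyclic_digraph_rank[OF D] by blast
  have "\<exists>a. a \<in> arcs D \<and> tail D a \<in> S \<and> head D a = v" if "v \<in> verts D - {s}" for v
    using dom[of v] that by (auto simp: arcs_ends_conv)
  then have "\<forall>v\<in>verts D - {s}. \<exists>a. a \<in> arcs D \<and> tail D a \<in> S \<and> head D a = v"
    by blast
  then obtain e where "\<forall>v\<in>verts D - {s}. e v \<in> arcs D \<and> tail D (e v) \<in> S \<and> head D (e v) = v"
    by (rule bchoice[THEN exE])
  then have e: "e v \<in> arcs D" "tail D (e v) \<in> S" "head D (e v) = v" if "v \<in> verts D - {s}" for v
    using that by blast+
  define T where "T = D\<lparr>arcs := e ` (verts D - {s})\<rparr>"
  have simps: "verts T = verts D" "arcs T = e ` (verts D - {s})" "tail T = tail D" "head T = head D"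
    by (simp_all add: T_def)
  have "arcs_ends T = (\<lambda>v. (tail D (e v), v)) ` (verts D - {s})"
    unfolding arcs_ends_conv simps image_image using e(3) by (intro image_cong) auto
  then have ends_T: "(u, v) \<in> arcs_ends T \<longleftrightarrow> v \<in> verts D - {s} \<and> u = tail D (e v)" for u v
    by auto
  have arcs_sub: "arcs T \<subseteq> arcs D"
    using e(1) by (auto simp: simps)
  have ends_sub: "arcs_ends T \<subseteq> arcs_ends D"
    unfolding arcs_ends_conv simps using e(1) by blast
  have dT: "digraph T"
  proof
    show "a = b" if "a \<in> arcs T" "b \<in> arcs T" "arc_to_ends T a = arc_to_ends T b" for a b
      using that arcs_sub by (intro no_multi_arcs) (auto simp: arc_to_ends_def simps(3,4))
  qed (use arcs_sub no_loops finite_subset[OF arcs_sub] in \<open>auto simp: simps(1,3,4)\<close>)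
  interpret T: digraph T by fact
  have reach: "s \<rightarrow>\<^sup>*\<^bsub>T\<^esub> v" if "v \<in> verts T" for v
    using that
  proof (induction "r v" arbitrary: v rule: less_induct)
    case less
    show ?case
    proof (cases "v = s")
      case False
      then have arc: "(tail D (e v), v) \<in> arcs_ends T"
        using less.prems by (simp add: ends_T simps)
      then have "r (tail D (e v)) < r v" "tail D (e v) \<in> verts T"
        using r ends_sub T.adj_in_verts(1)[OF arc] by auto
      then have "s \<rightarrow>\<^sup>*\<^bsub>T\<^esub> tail D (e v)"
        by (rule less.hyps)
      then show ?thesis
        using arc by (rule T.reachable_adj_trans)
    qed (use s in \<open>simp add: simps\<close>)
  qed
  have no_cycle: "\<not> 3 \<le> length p" if "pre_digraph.cycle (UG T) p" for p
  proof -
    have "length p < 3"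
    proof (rule no_undirected_cycle[OF _ _ that])
      show "r u < r v" if "(u, v) \<in> arcs_ends T" for u v
        using that ends_sub by (intro r) blast
    qed (simp add: ends_T)
    then show ?thesis by simp
  qed
  have "undirected_tree (UG T)"
    using connected_UG[OF T.wf_digraph _ reach] s no_cycle
    by (auto simp: undirected_tree_def simps)
  moreover have "(v, u) \<notin> arcs_ends T" if "(u, v) \<in> arcs_ends T" for u v
  proof -
    have "r u < r v" using that ends_sub by (intro r) blast
    moreover have "r v < r u" if "(v, u) \<in> arcs_ends T" using that ends_sub by (intro r) blast
    ultimately show ?thesis by auto
  qed
  ultimately have "oriented_tree T"
    using dT by (auto simp: oriented_tree_def)
  moreover have "in_degree T v = 0 \<longleftrightarrow> v = s" if "v \<in> verts T" for v
  proof -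
    have "in_degree T v = 0 \<longleftrightarrow> in_arcs T v = {}"
      unfolding in_degree_def using T.finite_in_arcs by simp
    also have "\<dots> \<longleftrightarrow> v = s"
    proof
      assume "v = s"
      moreover have "head D a \<noteq> s" if "a \<in> arcs T" for a
        using that e(3) by (fastforce simp: simps)
      ultimately show "in_arcs T v = {}" unfolding in_arcs_def simps(4) by blast
    next
      assume "in_arcs T v = {}"
      then have "e v \<notin> arcs T \<or> head D (e v) \<noteq> v" by (auto simp: in_arcs_def simps(4))
      then show "v = s" using e(3)[of v] that by (auto simp: simps)
    qed
    finally show ?thesis .
  qed
  ultimately have "out_tree T"
    using s by (auto simp: out_tree_def simps)
  moreover have "spanning T D"
    using arcs_sub T.wf_digraph wf_digraph
    by (auto simp: spanning_def subgraph_def compatible_def simps(1,3,4))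
  ultimately have "card (leaves T) \<le> max_leaves D"
    using card_le_max_leaves fin_digraph by (auto simp: out_branching_def)
  moreover have "verts D - S \<subseteq> leaves T"
    using e by (auto simp: leaves_def out_degree_def out_arcs_def simps)
  then have "card (verts D - S) \<le> card (leaves T)"
    by (rule card_mono[rotated]) (auto simp: leaves_def simps)
  ultimately show ?thesis by simp
qed

section \<open>The path decomposition\<close>

text \<open>
  Vertices are the numbers below \<open>n\<close>. The set \<open>S\<close> of the \<open>p\<close> with \<open>F p < n\<close> is an inclusion-minimal
  set meeting all in-neighbourhoods: \<open>F p\<close> is a vertex whose only in-neighbour in \<open>S\<close> is \<open>p\<close>.
  The value \<open>n\<close> marks the vertices outside \<open>S\<close>.
\<close>

locale private_choice =
  fixes n :: nat and E :: "nat \<Rightarrow> nat \<Rightarrow> bool" and F :: "nat \<Rightarrow> nat"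
  assumes F_le: "p < n \<Longrightarrow> F p \<le> n"
    and F_arc: "p < n \<Longrightarrow> F p < n \<Longrightarrow> E p (F p)"
    and F_private: "p < n \<Longrightarrow> F p < n \<Longrightarrow> u < n \<Longrightarrow> F u < n \<Longrightarrow> E u (F p) \<Longrightarrow> u = p"
    and dominated: "u < n \<Longrightarrow> v < n \<Longrightarrow> E u v \<Longrightarrow> \<exists>w<n. F w < n \<and> E w v"
begin

text \<open>This is F(S), the set of private out-neighbours, and not S itself.\<close>

definition chosen :: "nat set" where
  "chosen = F ` {p. p < n \<and> F p < n}"

text \<open>The first two alternatives describe Z, which is part of every bag. At the end of a path
  \<open>F y = n\<close>, and the last alternative holds for no \<open>i < n\<close>, so that final
  vertices need no special case.\<close>

definition bag :: "nat \<Rightarrow> nat list" where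
  "bag y = filter (\<lambda>i. F i = n \<or> i \<notin> chosen \<or> i = y \<or> i = F y) [0..<n]"

lemma F_inj: "p < n \<Longrightarrow> q < n \<Longrightarrow> F p < n \<Longrightarrow> F p = F q \<Longrightarrow> p = q"
  using F_arc[of p] F_private[of q p] by simp

text \<open>Injectivity of \<open>F\<close> on S gives F(S) the size of S, so as many vertices lie
  outside F(S) as outside S. This number is counted twice, and \<open>y\<close> and
  \<open>F y\<close> add 2.\<close>

lemma card_bag_le: "card (set (bag y)) \<le> 2 * card {i. i < n \<and> F i = n} + 2"
proof -
  let ?L = "{i. i < n \<and> F i = n}" and ?S = "{i. i < n \<and> F i < n}"
  have "{..<n} = ?S \<union> ?L"
    using F_le by (auto simp: le_less)
  moreover have "card (?S \<union> ?L) = card ?S + card ?L"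
    by (rule card_Un_disjoint) auto
  ultimately have S: "n = card ?S + card ?L"
    using card_lessThan[of n] by simp
  have "inj_on F ?S"
    using F_inj by (auto simp: inj_on_def)
  then have "card chosen = card ?S"
    unfolding chosen_def by (rule card_image)
  moreover have "chosen \<subseteq> {..<n}" "finite chosen"
    by (auto simp: chosen_def)
  ultimately have nc: "card ({..<n} - chosen) = card ?L"
    using S by (simp add: card_Diff_subset)
  have "set (bag y) \<subseteq> ?L \<union> (({..<n} - chosen) \<union> {y, F y})"
    by (auto simp: bag_def)
  then have "card (set (bag y)) \<le> card (?L \<union> (({..<n} - chosen) \<union> {y, F y}))"
    by (intro card_mono) auto
  also have "\<dots> \<le> card ?L + (card ({..<n} - chosen) + card {y, F y})"
    using card_Un_le[of ?L "({..<n} - chosen) \<union> {y, F y}"]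
      card_Un_le[of "{..<n} - chosen" "{y, F y}"] by linarith
  also have "card {y, F y} \<le> 2"
    by (simp add: card_insert_if)
  finally show ?thesis
    using nc by simp
qed

section \<open>The paths traced out by F\<close>

lemma chosenE:
  assumes "v \<in> chosen"
  obtains p where "p < n" "F p < n" "v = F p"
  using assms by (auto simp: chosen_def)

text \<open>A single list holds all paths one after the other. The third condition lets a path begin
  only outside F(S), the fourth lets it end only outside S. The last vertex of the list is exempt
  from the fourth, so that a list with an unfinished final path also qualifies, as it must during
  the traversal.\<close>

definition walks :: "nat list \<Rightarrow> bool" where
  "walks ys \<longleftrightarrow> distinct ys \<and> set ys \<subseteq> {..<n} \<and>
     (\<forall>i<length ys. ys ! i \<in> chosen \<longrightarrow> 0 < i \<and> ys ! i = F (ys ! (i - 1))) \<and>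
     (\<forall>i. Suc i < length ys \<longrightarrow> F (ys ! i) < n \<longrightarrow> ys ! Suc i = F (ys ! i))"

text \<open>Supplies what \<open>walks\<close> leaves open at the end of the list: the final path is
  complete.\<close>

definition ended :: "nat list \<Rightarrow> bool" where
  "ended ys \<longleftrightarrow> (ys \<noteq> [] \<longrightarrow> F (last ys) = n)"

lemma walksD:
  assumes "walks ys"
  shows "distinct ys" "set ys \<subseteq> {..<n}"
    and "\<And>i. i < length ys \<Longrightarrow> ys ! i \<in> chosen \<Longrightarrow> 0 < i \<and> ys ! i = F (ys ! (i - 1))"
    and "\<And>i. Suc i < length ys \<Longrightarrow> F (ys ! i) < n \<Longrightarrow> ys ! Suc i = F (ys ! i)"
  using assms by (simp_all add: walks_def)

lemma walks_Nil: "walks []" and ended_Nil: "ended []"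
  by (simp_all add: walks_def ended_def)

text \<open>Appending creates one new junction, and the last two hypotheses are the two path
  conditions there.\<close>

lemma walks_snoc:
  assumes "walks ys" "y < n" "y \<notin> set ys"
    and "y \<in> chosen \<Longrightarrow> ys \<noteq> [] \<and> y = F (last ys)"
    and "ys \<noteq> [] \<Longrightarrow> F (last ys) < n \<Longrightarrow> y = F (last ys)"
  shows "walks (ys @ [y])"
proof -
  have pred: "0 < i \<and> (ys @ [y]) ! i = F ((ys @ [y]) ! (i - 1))"
    if "i < Suc (length ys)" "(ys @ [y]) ! i \<in> chosen" for i
  proof (cases "i = length ys")
    case True
    then show ?thesis
      using that(2) assms(4) by (simp add: nth_append last_conv_nth)
  next
    case False
    then have "i < length ys" "i - 1 < length ys"
      using that(1) by auto
    then show ?thesis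
      using that(2) walksD(3)[OF assms(1), of i] by (simp add: nth_append)
  qed
  have succ: "(ys @ [y]) ! Suc i = F ((ys @ [y]) ! i)"
    if "i < length ys" "F ((ys @ [y]) ! i) < n" for i
  proof (cases "Suc i = length ys")
    case True
    then have "ys \<noteq> []" "length ys - 1 = i"
      by auto
    then have "last ys = ys ! i" "ys \<noteq> []"
      using last_conv_nth[of ys] by simp_all
    then show ?thesis
      using that True assms(5) by (simp add: nth_append)
  next
    case False
    then show ?thesis
      using that walksD(4)[OF assms(1), of i] by (simp add: nth_append)
  qed
  show ?thesis
    unfolding walks_def
  proof (intro conjI allI impI)
    show "distinct (ys @ [y])" "set (ys @ [y]) \<subseteq> {..<n}"
      using assms(2,3) walksD(1,2)[OF assms(1)] by auto
    fix i
    { assume "i < length (ys @ [y])" "(ys @ [y]) ! i \<in> chosen"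
      then show "0 < i" "(ys @ [y]) ! i = F ((ys @ [y]) ! (i - 1))"
        using pred[of i] by simp_all }
    assume "Suc i < length (ys @ [y])" "F ((ys @ [y]) ! i) < n"
    then show "(ys @ [y]) ! Suc i = F ((ys @ [y]) ! i)"
      using succ[of i] by simp
  qed
qed

lemma walks_start:
  assumes "walks ys" "ended ys" "y < n" "y \<notin> set ys" "y \<notin> chosen"
  shows "walks (ys @ [y])"
  using assms by (intro walks_snoc) (auto simp: ended_def)

text \<open>If \<open>F y\<close> occurred already, then, being in F(S), it would be preceded by a
  vertex with the same image as \<open>y\<close>. By injectivity that vertex is \<open>y\<close>,
  but it stands strictly before the end of a list without repetitions.\<close>

lemma walks_step:
  assumes "walks (ys @ [y])" "F y < n"
  shows "walks ((ys @ [y]) @ [F y])"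
proof (rule walks_snoc)
  let ?zs = "ys @ [y]"
  have y: "y < n" "y \<notin> set ys"
    using walksD(1,2)[OF assms(1)] by auto
  show "F y \<notin> set ?zs"
  proof
    assume "F y \<in> set ?zs"
    then obtain i where i: "i < length ?zs" "?zs ! i = F y"
      by (metis in_set_conv_nth)
    have "F y \<in> chosen"
      using y assms(2) by (auto simp: chosen_def)
    then have i': "0 < i" "F (?zs ! (i - 1)) = F y"
      using walksD(3)[OF assms(1) i(1)] i(2) by auto
    define p where "p = ?zs ! (i - 1)"
    have "p \<in> set ys"
      using i(1) i'(1) by (auto simp: p_def nth_append)
    moreover have "set ys \<subseteq> {..<n}"
      using walksD(2)[OF assms(1)] by auto
    ultimately have "y = p"
      using y(1) assms(2) i'(2) by - (rule F_inj; auto simp: p_def)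
    with \<open>p \<in> set ys\<close> have "y \<in> set ys" by simp
    then show False using y(2) by simp
  qed
qed (use assms in auto)

text \<open>Outside Z a vertex enters only its own bag and that of its preimage under
  \<open>F\<close>, and the path conditions put the preimage directly before it. The bags containing
  it therefore form an interval, which is what \<open>bag_convex\<close> needs.\<close>

lemma chosen_in_bag_iff:
  assumes "walks ys" "set ys = {..<n}" "ended ys" "F a \<noteq> n" "a \<in> chosen" "h < length ys"
    and q: "q < length ys" "ys ! q = a"
  shows "a \<in> set (bag (ys ! h)) \<longleftrightarrow> h = q \<or> Suc h = q"
proof
  have a: "a < n"
    using assms(2) q by (metis lessThan_iff nth_mem)
  { assume "h = q \<or> Suc h = q"
    then have "ys ! h = a \<or> F (ys ! h) = a"
      using walksD(3)[OF assms(1) q(1)] assms(5) q by auto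
    then show "a \<in> set (bag (ys ! h))"
      using a by (auto simp: bag_def) }
  assume "a \<in> set (bag (ys ! h))"
  then consider "ys ! h = a" | "F (ys ! h) = a"
    using assms(4,5) by (auto simp: bag_def)
  then show "h = q \<or> Suc h = q"
  proof cases
    case 1
    then show ?thesis
      using walksD(1)[OF assms(1)] assms(6) q by (auto simp: nth_eq_iff_index_eq)
  next
    case 2
    \<comment> \<open>At the last position \<open>F\<close> takes the value n because of
      \<open>ended\<close>, whereas here its value is \<open>a < n\<close>.\<close>
    have "Suc h < length ys"
    proof (rule ccontr)
      assume "\<not> Suc h < length ys"
      then have "h = length ys - 1" "ys \<noteq> []" using assms(6) by auto
      then show False
        using 2 a assms(3) by (simp add: ended_def last_conv_nth)
    qed
    moreover have "ys ! Suc h = a"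
      using calculation 2 a walksD(4)[OF assms(1), of h] by simp
    ultimately have "Suc h = q"
      using walksD(1)[OF assms(1)] q by (auto simp: nth_eq_iff_index_eq)
    then show ?thesis ..
  qed
qed

lemma bag_convex:
  assumes "walks ys" "set ys = {..<n}" "ended ys" "h \<le> i" "i \<le> j" "j < length ys"
    and "a \<in> set (bag (ys ! h))" "a \<in> set (bag (ys ! j))"
  shows "a \<in> set (bag (ys ! i))"
proof (cases "F a = n \<or> a \<notin> chosen")
  case True
  then show ?thesis
    using assms(7) by (auto simp: bag_def)
next
  case False
  have "a \<in> set ys"
    using assms(2,7) by (auto simp: bag_def)
  then obtain q where q: "q < length ys" "ys ! q = a"
    by (metis in_set_conv_nth)
  note iff = chosen_in_bag_iff[OF assms(1-3) _ _ _ q]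
  have "h = q \<or> Suc h = q" "j = q \<or> Suc j = q"
    using iff False assms(4-8) by auto
  then have "i = q \<or> Suc i = q"
    using assms(4,5) by auto
  then show ?thesis
    using iff[of i] False assms(5,6) by auto
qed

text \<open>If \<open>i\<close> is in Z, the bag of \<open>j\<close> serves. Otherwise the bag of
  \<open>i\<close> does: either \<open>j\<close> is in Z, or \<open>j\<close> is a private
  out-neighbour and its only in-neighbour in S must be \<open>i\<close>.\<close>

lemma bag_covers_arc:
  assumes "E i j" "i < n" "j < n"
  shows "\<exists>y<n. i \<in> set (bag y) \<and> j \<in> set (bag y)"
proof (cases "F i = n \<or> i \<notin> chosen")
  case True
  then have "i \<in> set (bag j)" "j \<in> set (bag j)"
    using assms by (auto simp: bag_def)
  then show ?thesis using assms(3) by blast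
next
  case False
  have "j \<in> set (bag i)"
  proof (cases "F j = n \<or> j \<notin> chosen")
    case True
    then show ?thesis using assms by (auto simp: bag_def)
  next
    case j: False
    then obtain p where p: "p < n" "F p < n" "j = F p"
      by (auto elim: chosenE)
    then have "i = p"
      using F_private[of p i] assms False F_le[of i] by simp
    then show ?thesis
      using p assms by (simp add: bag_def)
  qed
  then show ?thesis
    using assms by (auto simp: bag_def)
qed

text \<open>By induction on the rank, the preimage of a vertex of F(S) is on the list, and its
  successor there is the vertex itself. The rank excludes closed orbits of \<open>F\<close>, which
  no starting vertex would lead into.\<close>

lemma walks_exhaustive:
  fixes r :: "nat \<Rightarrow> nat"
  assumes rank: "\<And>u v. u < n \<Longrightarrow> v < n \<Longrightarrow> E u v \<Longrightarrow> r u < r v"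
    and "walks ys" "ended ys" and starts: "\<And>x. x < n \<Longrightarrow> x \<notin> chosen \<Longrightarrow> x \<in> set ys"
  shows "set ys = {..<n}"
proof -
  have "v \<in> set ys" if "v < n" for v
    using that
  proof (induction "r v" arbitrary: v rule: less_induct)
    case less
    show ?case
    proof (cases "v \<in> chosen")
      case True
      then obtain p where p: "p < n" "F p < n" "v = F p"
        by (auto elim: chosenE)
      then have "p \<in> set ys"
        using less F_arc rank by simp
      then obtain i where i: "i < length ys" "ys ! i = p"
        by (metis in_set_conv_nth)
      have "Suc i < length ys"
      proof (rule ccontr)
        assume "\<not> Suc i < length ys"
        then have "i = length ys - 1" "ys \<noteq> []" using i by auto
        then show False
          using p i assms(3) by (simp add: ended_def last_conv_nth)
      qed
      moreover have "ys ! Suc i = v"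
        using calculation walksD(4)[OF assms(2), of i] i p by simp
      ultimately show ?thesis
        using nth_mem by blast
    qed (use less starts in simp)
  qed
  then show ?thesis
    using walksD(2)[OF assms(2)] by auto
qed

end

section \<open>From vertex numbers to bags of vertices\<close>

lemma path_decomposition_bags:
  fixes D :: "('a, 'b) pre_digraph"
  assumes "wf_digraph D" "distinct vs" "set vs = verts D" "verts D \<noteq> {}"
    and "private_choice (length vs) (\<lambda>i j. (vs ! i, vs ! j) \<in> arcs_ends D) F"
    and ys: "private_choice.walks (length vs) F ys" "private_choice.ended (length vs) F ys"
      "set ys = {..<length vs}"
  shows "path_decomposition (UG D)
           (map (\<lambda>y. (!) vs ` set (private_choice.bag (length vs) F y)) ys)" (is "path_decomposition _ ?Xs")
proof -
  interpret wf_digraph D by fact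
  interpret private_choice "length vs" "\<lambda>i j. (vs ! i, vs ! j) \<in> arcs_ends D" F by fact
  have bag_sub: "set (bag y) \<subseteq> {..<length vs}" for y
    by (auto simp: bag_def)
  \<comment> \<open>Distinctness of \<open>vs\<close> allows passing back from a vertex in an image
    to its position in the bag; the interval condition relies on this.\<close>
  have in_bag: "vs ! i \<in> (!) vs ` set (bag y) \<longleftrightarrow> i \<in> set (bag y)" if "i < length vs" for i y
    using that bag_sub[of y] assms(2) by (auto simp: nth_eq_iff_index_eq)
  have own: "i \<in> set (bag i)" if "i < length vs" for i
    using that by (simp add: bag_def)
  have idx: "\<exists>i<length vs. v = vs ! i" if "v \<in> verts D" for v
    using that assms(3) by (metis in_set_conv_nth)
  have arc: "\<exists>X\<in>set ?Xs. u \<in> X \<and> v \<in> X" if uv: "(u, v) \<in> arcs_ends D" for u v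
  proof -
    obtain i j where ij: "i < length vs" "j < length vs" "u = vs ! i" "v = vs ! j"
      using idx adj_in_verts[OF uv] by blast
    then obtain y where "y < length vs" "i \<in> set (bag y)" "j \<in> set (bag y)"
      using bag_covers_arc uv by blast
    then show ?thesis
      using ij ys(3) by auto
  qed
  show ?thesis
    unfolding path_decomposition_def
  proof (intro conjI allI impI)
    show "?Xs \<noteq> []"
      using assms(3,4) ys(3) by (cases vs) auto
    have "(!) vs ` (\<Union>y\<in>{..<length vs}. set (bag y)) = verts D"
    proof -
      have "(\<Union>y\<in>{..<length vs}. set (bag y)) = {..<length vs}"
        using own bag_sub by blast
      then show ?thesis
        using assms(3) by (auto simp: set_conv_nth)
    qed
    then show "\<Union> (set ?Xs) = verts (UG D)"
      using ys(3) by (simp add: image_UN)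
  next
    fix u v assume "(u, v) \<in> arcs_ends (UG D)"
    then have "(u, v) \<in> arcs_ends D \<or> (v, u) \<in> arcs_ends D"
      by (auto simp: parcs_mk_symmetric arcs_ends_conv)
    then show "\<exists>X\<in>set ?Xs. u \<in> X \<and> v \<in> X"
      using arc by blast
  next
    fix v h i j assume *: "h \<le> i \<and> i \<le> j \<and> j < length ?Xs \<and> v \<in> ?Xs ! h \<and> v \<in> ?Xs ! j"
    then have "v \<in> (!) vs ` set (bag (ys ! h))" "v \<in> (!) vs ` set (bag (ys ! j))"
      by auto
    then obtain a where a: "v = vs ! a" "a < length vs" "a \<in> set (bag (ys ! h))"
      using bag_sub by blast
    from \<open>v \<in> (!) vs ` set (bag (ys ! j))\<close> have "a \<in> set (bag (ys ! j))"
      using in_bag a by simp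
    then have "a \<in> set (bag (ys ! i))"
      using bag_convex[OF ys(1) ys(3) ys(2), of h i j a] * a by auto
    then show "v \<in> ?Xs ! i"
      using * a by simp
  qed
qed

lemma width_bags_le:
  assumes "private_choice (length vs) E F" "ys \<noteq> []"
  shows "width (map (\<lambda>y. (!) vs ` set (private_choice.bag (length vs) F y)) ys)
    \<le> 2 * int (card {i. i < length vs \<and> F i = length vs}) + 1"
proof -
  interpret private_choice "length vs" E F by fact
  have "card ((!) vs ` set (bag y)) \<le> 2 * card {i. i < length vs \<and> F i = length vs} + 2" for y
    using card_image_le[of "set (bag y)" "(!) vs"] card_bag_le[of y] by simp
  then have "Max (card ` set (map (\<lambda>y. (!) vs ` set (bag y)) ys))
      \<le> 2 * card {i. i < length vs \<and> F i = length vs} + 2"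
    using assms(2) by (subst Max_le_iff) auto
  then show ?thesis
    by (simp add: width_def)
qed

section \<open>The program\<close>

definition runs :: "com \<Rightarrow> memory \<Rightarrow> nat list \<Rightarrow> nat \<Rightarrow> (memory \<Rightarrow> nat list \<Rightarrow> bool) \<Rightarrow> bool" where
  "runs c M out T Q \<longleftrightarrow> (\<exists>t M' out'. exec c (M, out) t (M', out') \<and> t \<le> T \<and> Q M' out')"

lemma runsI:
  "exec c (M, out) t (M', out') \<Longrightarrow> t \<le> T \<Longrightarrow> Q M' out' \<Longrightarrow> runs c M out T Q"
  unfolding runs_def by blast

lemma runsE:
  assumes "runs c M out T Q"
  obtains t M' out' where "exec c (M, out) t (M', out')" "t \<le> T" "Q M' out'"
  using assms unfolding runs_def by blast

text \<open>Since \<open>runs\<close> bounds the time instead of fixing it, branches of different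
  cost can be given a common bound.\<close>

lemma runs_mono:
  assumes "runs c M out T Q" "T \<le> T'" "\<And>M' out'. Q M' out' \<Longrightarrow> Q' M' out'"
  shows "runs c M out T' Q'"
proof -
  obtain t M1 out1 where 1: "exec c (M, out) t (M1, out1)" "t \<le> T" "Q M1 out1"
    using assms(1) by (rule runsE)
  show ?thesis
    using 1(1) le_trans[OF 1(2) assms(2)] assms(3)[OF 1(3)] by (rule runsI)
qed

lemma runs_SKIP: "Q M out \<Longrightarrow> 1 \<le> T \<Longrightarrow> runs SKIP M out T Q"
  by (rule runsI[OF exec.Skip])

lemma runs_STORE:
  "Q (M(x := (M x)(eval M e1 := eval M e2))) out \<Longrightarrow> 1 \<le> T \<Longrightarrow> runs (STORE x e1 e2) M out T Q"
  by (rule runsI[OF exec.Store])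

lemma runs_EMIT: "Q M (out @ [eval M e]) \<Longrightarrow> 1 \<le> T \<Longrightarrow> runs (EMIT e) M out T Q"
  by (rule runsI[OF exec.Emit])

lemma runs_SEQ:
  assumes "runs c1 M out T1 R" "\<And>M' out'. R M' out' \<Longrightarrow> runs c2 M' out' T2 Q"
  shows "runs (SEQ c1 c2) M out (T1 + T2) Q"
proof -
  obtain t1 M1 out1 where 1: "exec c1 (M, out) t1 (M1, out1)" "t1 \<le> T1" "R M1 out1"
    using assms(1) by (rule runsE)
  obtain t2 M2 out2 where 2: "exec c2 (M1, out1) t2 (M2, out2)" "t2 \<le> T2" "Q M2 out2"
    using assms(2)[OF 1(3)] by (rule runsE)
  show ?thesis
    using exec.Seq[OF 1(1) 2(1)] add_mono[OF 1(2) 2(2)] 2(3) by (rule runsI)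
qed

lemma runs_STORE_SEQ:
  assumes "runs c (M(x := (M x)(eval M e1 := eval M e2))) out T Q"
  shows "runs (SEQ (STORE x e1 e2) c) M out (1 + T) Q"
proof (rule runs_SEQ)
  show "runs (STORE x e1 e2) M out 1
      (\<lambda>M' out'. M' = M(x := (M x)(eval M e1 := eval M e2)) \<and> out' = out)"
    by (rule runs_STORE) simp_all
qed (use assms in simp)

lemma runs_IF:
  assumes "eval M e \<noteq> 0 \<Longrightarrow> runs c1 M out T Q" "eval M e = 0 \<Longrightarrow> runs c2 M out T Q"
  shows "runs (IF e c1 c2) M out (T + 1) Q"
proof (cases "eval M e = 0")
  case True
  show ?thesis
    by (rule runsE[OF assms(2)[OF True]], rule runsI[OF exec.IfFalse[OF True]]) auto
next
  case False
  show ?thesis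
    by (rule runsE[OF assms(1)[OF False]], rule runsI[OF exec.IfTrue[OF False]]) auto
qed

text \<open>The invariant carries a number m of rounds still allowed. It is only an upper bound, and
  the loop may stop early: the length of a path is not known in advance. A round costs its body and
  one test, and one more test ends the loop.\<close>

lemma runs_WHILE:
  assumes "I m M out"
    and "\<And>M out. I 0 M out \<Longrightarrow> eval M e = 0"
    and step: "\<And>m M out. I (Suc m) M out \<Longrightarrow> eval M e \<noteq> 0 \<Longrightarrow> runs c M out T (I m)"
    and post: "\<And>m M out. I m M out \<Longrightarrow> eval M e = 0 \<Longrightarrow> Q M out"
  shows "runs (WHILE e c) M out (m * (T + 1) + 1) Q"
  using assms(1)
proof (induction m arbitrary: M out)
  case 0
  then have "eval M e = 0"
    by (rule assms(2))
  then show ?case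
    using 0 by (intro runsI[OF exec.WhileFalse] post) auto
next
  case (Suc m)
  show ?case
  proof (cases "eval M e = 0")
    case True
    then show ?thesis
      using Suc.prems by (intro runsI[OF exec.WhileFalse] post) auto
  next
    case False
    obtain t1 M1 out1 where 1: "exec c (M, out) t1 (M1, out1)" "t1 \<le> T" "I m M1 out1"
      using step[OF Suc.prems False] by (rule runsE)
    obtain t2 M2 out2 where 2: "exec (WHILE e c) (M1, out1) t2 (M2, out2)"
        "t2 \<le> m * (T + 1) + 1" "Q M2 out2"
      using Suc.IH[OF 1(3)] by (rule runsE)
    have "exec (WHILE e c) (M, out) (t1 + t2 + 1) (M2, out2)"
      using False 1(1) 2(1) by (rule exec.WhileTrue)
    moreover have "t1 + t2 + 1 \<le> Suc m * (T + 1) + 1"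
      using 1(2) 2(2) by simp
    ultimately show ?thesis
      using 2(3) by (rule runsI)
  qed
qed

abbreviation V :: "string \<Rightarrow> expr" where
  "V x \<equiv> Load x (Lit 0)"

definition FOR :: "string \<Rightarrow> com \<Rightarrow> com" where
  "FOR x c = SEQ (STORE x (Lit 0) (Lit 0))
     (WHILE (Less (V x) (V ''n'')) (SEQ c (STORE x (Lit 0) (Add (V x) (Lit 1)))))"

text \<open>Each round pays for the body, the increment and the test; the final 2 are the initial
  store and the failing test. The invariant is required after the increment, so it may itself speak
  of the counter.\<close>

lemma runs_FOR:
  assumes n: "M ''n'' 0 = n" and x: "x \<noteq> ''n''"
    and init: "I 0 (M(x := (M x)(0 := 0))) out"
    and step: "\<And>j M out. j < n \<Longrightarrow> M ''n'' 0 = n \<Longrightarrow> M x 0 = j \<Longrightarrow> I j M out \<Longrightarrow>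
      runs c M out T (\<lambda>M' out'. M' ''n'' 0 = n \<and> M' x 0 = j \<and> I (Suc j) (M'(x := (M' x)(0 := Suc j))) out')"
    and post: "\<And>M out. I n M out \<Longrightarrow> Q M out"
  shows "runs (FOR x c) M out (n * (T + 2) + 2) Q"
proof -
  \<comment> \<open>The loop rule counts the remaining rounds m downwards, the invariant of the
    caller counts the finished ones, n - m.\<close>
  let ?J = "\<lambda>m M out. m \<le> n \<and> M ''n'' 0 = n \<and> M x 0 = n - m \<and> I (n - m) M out"
  have "runs (WHILE (Less (V x) (V ''n'')) (SEQ c (STORE x (Lit 0) (Add (V x) (Lit 1)))))
      (M(x := (M x)(0 := 0))) out (n * (T + 1 + 1) + 1) Q"
  proof (rule runs_WHILE[where I = ?J])
    fix m M out
    assume J: "?J (Suc m) M out"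
    then have m: "n - Suc m < n" "Suc (n - Suc m) = n - m" by auto
    show "runs (SEQ c (STORE x (Lit 0) (Add (V x) (Lit 1)))) M out (T + 1) (?J m)"
      by (rule runs_SEQ, rule step[OF m(1)]) (use J m x in \<open>auto intro!: runs_STORE\<close>)
  next
    fix m M out
    assume "?J m M out" "eval M (Less (V x) (V ''n'')) = 0"
    then have "m = 0" "I (n - m) M out" by (auto split: if_splits)
    then show "Q M out" using post by simp
  qed (use n x init in auto)
  then have "runs (FOR x c) M out (1 + (n * (T + 1 + 1) + 1)) Q"
    unfolding FOR_def by (intro runs_STORE_SEQ) simp
  then show ?thesis
    by (rule runs_mono) auto
qed

text \<open>A frame condition: only the arrays named in \<open>X\<close> may have changed.\<close>

definition same_but :: "string set \<Rightarrow> memory \<Rightarrow> memory \<Rightarrow> bool" where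
  "same_but X M M' \<longleftrightarrow> (\<forall>x. x \<notin> X \<longrightarrow> M' x = M x)"

text \<open>Tabulates the row offsets \<open>i * n\<close>, as the machine cannot multiply.\<close>

definition row_program :: com where
  "row_program = FOR ''i'' (STORE ''R'' (Add (V ''i'') (Lit 1)) (Add (Load ''R'' (V ''i'')) (V ''n'')))"

lemma runs_row_program:
  assumes "M ''n'' 0 = n" "M ''R'' 0 = 0"
  shows "runs row_program M out (3 * n + 2)
    (\<lambda>M' out'. out' = out \<and> same_but {''i'', ''R''} M M' \<and> (\<forall>i\<le>n. M' ''R'' i = i * n))"
proof -
  let ?I = "\<lambda>j M' out'. out' = out \<and> same_but {''i'', ''R''} M M' \<and> (\<forall>i\<le>j. M' ''R'' i = i * n)"
  have "runs row_program M out (n * (1 + 2) + 2) (?I n)"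
    unfolding row_program_def
  proof (rule runs_FOR[where n = n and I = ?I])
    fix j M' out'
    assume j: "j < n" "M' ''n'' 0 = n" "M' ''i'' 0 = j" and I: "?I j M' out'"
    show "runs (STORE ''R'' (Add (V ''i'') (Lit 1)) (Add (Load ''R'' (V ''i'')) (V ''n''))) M' out' 1
       (\<lambda>M' out'. M' ''n'' 0 = n \<and> M' ''i'' 0 = j \<and> ?I (Suc j) (M'(''i'' := (M' ''i'')(0 := Suc j))) out')"
      by (rule runs_STORE) (use j I in \<open>auto simp: same_but_def le_Suc_eq\<close>)
  qed (use assms in \<open>auto simp: same_but_def\<close>)
  then show ?thesis by (rule runs_mono) auto
qed

section \<open>Finding S and F by elimination\<close>

definition arc_expr :: "string \<Rightarrow> string \<Rightarrow> expr" where
  "arc_expr x y = Load ''A'' (Add (Load ''R'' (V x)) (V y))"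

definition stores_graph :: "nat \<Rightarrow> (nat \<Rightarrow> nat \<Rightarrow> bool) \<Rightarrow> memory \<Rightarrow> bool" where
  "stores_graph n E M \<longleftrightarrow> M ''n'' 0 = n \<and> (\<forall>i\<le>n. M ''R'' i = i * n) \<and>
     (\<forall>u<n. \<forall>v<n. M ''A'' (u * n + v) = of_bool (E u v))"

lemma stores_graph_cong:
  assumes "stores_graph n E M" "M' ''n'' = M ''n''" "M' ''R'' = M ''R''" "M' ''A'' = M ''A''"
  shows "stores_graph n E M'"
  using assms by (simp add: stores_graph_def)

lemma eval_arc_expr:
  assumes "stores_graph n E M" "M x 0 < n" "M y 0 < n"
  shows "eval M (arc_expr x y) = of_bool (E (M x 0) (M y 0))"
  using assms by (simp add: stores_graph_def arc_expr_def)

text \<open>Conjunction is expressed by arithmetic: two truth values are both 1 exactly if 1 is less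
  than their sum.\<close>

definition count_program :: com where
  "count_program = SEQ (STORE ''b'' (Lit 0) (Lit 0))
     (FOR ''u'' (STORE ''b'' (Lit 0) (Add (V ''b'')
       (Less (Lit 1) (Add (Less (Load ''F'' (V ''u'')) (V ''n'')) (arc_expr ''u'' ''v''))))))"

lemma runs_count_program:
  assumes G: "stores_graph n E M" and v: "M ''v'' 0 = v" "v < n"
  shows "runs count_program M out (3 * n + 3)
    (\<lambda>M' out'. out' = out \<and> same_but {''b'', ''u''} M M' \<and>
       (M' ''b'' 0 = 0 \<longleftrightarrow> \<not> (\<exists>u<n. M ''F'' u < n \<and> E u v)))"
proof -
  let ?I = "\<lambda>j M' out'. out' = out \<and> same_but {''b'', ''u''} M M' \<and>
       (M' ''b'' 0 = 0 \<longleftrightarrow> \<not> (\<exists>u<j. M ''F'' u < n \<and> E u v))"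
  have "runs count_program M out (1 + (n * (1 + 2) + 2)) (?I n)"
    unfolding count_program_def
  proof (rule runs_STORE_SEQ, rule runs_FOR[where n = n and I = ?I])
    fix j M' out'
    assume j: "j < n" "M' ''n'' 0 = n" "M' ''u'' 0 = j" and I: "?I j M' out'"
    have "stores_graph n E M'"
      using G by (rule stores_graph_cong) (use I in \<open>simp_all add: same_but_def\<close>)
    then have arc: "eval M' (arc_expr ''u'' ''v'') = of_bool (E j v)"
      using j I v by (subst eval_arc_expr) (auto simp: same_but_def)
    show "runs (STORE ''b'' (Lit 0) (Add (V ''b'')
       (Less (Lit 1) (Add (Less (Load ''F'' (V ''u'')) (V ''n'')) (arc_expr ''u'' ''v''))))) M' out' 1
       (\<lambda>M' out'. M' ''n'' 0 = n \<and> M' ''u'' 0 = j \<and> ?I (Suc j) (M'(''u'' := (M' ''u'')(0 := Suc j))) out')"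
      by (rule runs_STORE) (use j I arc in \<open>auto simp: same_but_def less_Suc_eq\<close>)
  qed (use G in \<open>auto simp: stores_graph_def same_but_def\<close>)
  then show ?thesis by (rule runs_mono) auto
qed

text \<open>This is run while \<open>p\<close> is tentatively outside S. Comparing the count with
  the arc bit tests both that the count is 0 and that the arc exists, so \<open>v\<close> would lose
  its last in-neighbour in S. Of several such \<open>v\<close> the last one is kept.\<close>

definition select_program :: com where
  "select_program = FOR ''v'' (SEQ count_program
     (IF (Less (V ''b'') (arc_expr ''p'' ''v'')) (STORE ''t'' (Lit 0) (V ''v'')) SKIP))"

text \<open>Meant for an \<open>F\<close> that already has the value n at \<open>p\<close>. The
  prefix length j matters only while nothing has been found, since a vertex once found stays
  suitable.\<close>

definition selects :: "nat \<Rightarrow> (nat \<Rightarrow> nat \<Rightarrow> bool) \<Rightarrow> (nat \<Rightarrow> nat) \<Rightarrow> nat \<Rightarrow> nat \<Rightarrow> nat \<Rightarrow> bool" where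
  "selects n E F p j t \<longleftrightarrow>
     (if t < n then E p t \<and> \<not> (\<exists>u<n. F u < n \<and> E u t)
      else t = n \<and> (\<forall>v<j. E p v \<longrightarrow> (\<exists>u<n. F u < n \<and> E u v)))"

lemma runs_select_program:
  assumes G: "stores_graph n E M" and p: "M ''p'' 0 = p" "p < n" and t: "M ''t'' 0 = n"
  shows "runs select_program M out (n * (3 * n + 7) + 2)
    (\<lambda>M' out'. out' = out \<and> same_but {''b'', ''u'', ''v'', ''t''} M M' \<and>
       selects n E (M ''F'') p n (M' ''t'' 0))"
proof -
  let ?I = "\<lambda>j M' out'. out' = out \<and> same_but {''b'', ''u'', ''v'', ''t''} M M' \<and>
       selects n E (M ''F'') p j (M' ''t'' 0)"
  have "runs select_program M out (n * (3 * n + 3 + (1 + 1) + 2) + 2) (?I n)"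
    unfolding select_program_def
  proof (rule runs_FOR[where n = n and I = ?I])
    fix j M1 out1
    assume j: "j < n" "M1 ''n'' 0 = n" "M1 ''v'' 0 = j" and I: "?I j M1 out1"
    have G1: "stores_graph n E M1"
      using G by (rule stores_graph_cong) (use I in \<open>simp_all add: same_but_def\<close>)
    have F1: "M1 ''F'' = M ''F''"
      using I by (simp add: same_but_def)
    show "runs (SEQ count_program
       (IF (Less (V ''b'') (arc_expr ''p'' ''v'')) (STORE ''t'' (Lit 0) (V ''v'')) SKIP))
       M1 out1 (3 * n + 3 + (1 + 1))
       (\<lambda>M' out'. M' ''n'' 0 = n \<and> M' ''v'' 0 = j \<and> ?I (Suc j) (M'(''v'' := (M' ''v'')(0 := Suc j))) out')"
    proof (rule runs_SEQ, rule runs_count_program[OF G1 j(3,1)])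
      fix M2 out2
      assume 2: "out2 = out1 \<and> same_but {''b'', ''u''} M1 M2 \<and>
       (M2 ''b'' 0 = 0 \<longleftrightarrow> \<not> (\<exists>u<n. M1 ''F'' u < n \<and> E u j))"
      have "stores_graph n E M2"
        using G1 by (rule stores_graph_cong) (use 2 in \<open>simp_all add: same_but_def\<close>)
      then have arc: "eval M2 (arc_expr ''p'' ''v'') = of_bool (E p j)"
        using j I 2 p by (subst eval_arc_expr) (auto simp: same_but_def)
      have less: "eval M2 (Less (V ''b'') (arc_expr ''p'' ''v'')) \<noteq> 0 \<longleftrightarrow>
          E p j \<and> \<not> (\<exists>u<n. M ''F'' u < n \<and> E u j)"
        using 2 arc F1 by auto
      have same: "same_but {''b'', ''u'', ''v'', ''t''} M M2" "M2 ''t'' = M1 ''t''" "M2 ''v'' 0 = j" "M2 ''n'' 0 = n"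
        using 2 I j by (auto simp: same_but_def)
      show "runs (IF (Less (V ''b'') (arc_expr ''p'' ''v'')) (STORE ''t'' (Lit 0) (V ''v'')) SKIP) M2 out2
        (1 + 1) (\<lambda>M' out'. M' ''n'' 0 = n \<and> M' ''v'' 0 = j \<and> ?I (Suc j) (M'(''v'' := (M' ''v'')(0 := Suc j))) out')"
      proof (rule runs_IF)
        assume "eval M2 (Less (V ''b'') (arc_expr ''p'' ''v'')) \<noteq> 0"
        then have "selects n E (M ''F'') p (Suc j) j"
          using less j by (simp add: selects_def)
        then show "runs (STORE ''t'' (Lit 0) (V ''v'')) M2 out2 1
          (\<lambda>M' out'. M' ''n'' 0 = n \<and> M' ''v'' 0 = j \<and> ?I (Suc j) (M'(''v'' := (M' ''v'')(0 := Suc j))) out')"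
          by (intro runs_STORE) (use same 2 I in \<open>auto simp: same_but_def\<close>)
      next
        assume "eval M2 (Less (V ''b'') (arc_expr ''p'' ''v'')) = 0"
        then have "E p j \<longrightarrow> (\<exists>u<n. M ''F'' u < n \<and> E u j)"
          using less by blast
        then have "selects n E (M ''F'') p (Suc j) (M1 ''t'' 0)"
          using I unfolding selects_def by (auto simp: less_Suc_eq)
        then show "runs SKIP M2 out2 1
          (\<lambda>M' out'. M' ''n'' 0 = n \<and> M' ''v'' 0 = j \<and> ?I (Suc j) (M'(''v'' := (M' ''v'')(0 := Suc j))) out')"
          by (intro runs_SKIP) (use same 2 I in \<open>auto simp: same_but_def\<close>)
      qed
    qed
  qed (use G t in \<open>auto simp: stores_graph_def same_but_def selects_def\<close>)
  then show ?thesis by (rule runs_mono) (auto simp: algebra_simps)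
qed

text \<open>
  The invariant of the elimination: the first \<open>j\<close> vertices have been treated, the others still
  belong to \<open>S\<close> (their entry of \<open>F\<close> only matters by being less than \<open>n\<close>).
\<close>

definition partial_choice :: "nat \<Rightarrow> (nat \<Rightarrow> nat \<Rightarrow> bool) \<Rightarrow> nat \<Rightarrow> (nat \<Rightarrow> nat) \<Rightarrow> bool" where
  "partial_choice n E j F \<longleftrightarrow>
     (\<forall>p<n. F p \<le> n) \<and> (\<forall>p<n. j \<le> p \<longrightarrow> F p < n) \<and>
     (\<forall>p<j. F p < n \<longrightarrow> E p (F p) \<and> (\<forall>u<n. F u < n \<and> E u (F p) \<longrightarrow> u = p)) \<and>
     (\<forall>u<n. \<forall>v<n. E u v \<longrightarrow> (\<exists>w<n. F w < n \<and> E w v))"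

lemma partial_choice_step:
  assumes F: "partial_choice n E j F" and "j < n" and t: "selects n E (F(j := n)) j n t"
  shows "partial_choice n E (Suc j) (F(j := t))"
proof -
  let ?F = "F(j := t)"
  have le: "t \<le> n"
    using t by (auto simp: selects_def split: if_splits)
  \<comment> \<open>An untreated vertex belongs to S, so whatever the value t at j is, the new S is
    contained in the old one. Hence earlier private out-neighbours remain private.\<close>
  have shrink: "F u < n" if "?F u < n" for u
    using that F \<open>j < n\<close> by (cases "u = j") (auto simp: partial_choice_def)
  have other: "(F(j := n)) u < n \<longleftrightarrow> u \<noteq> j \<and> ?F u < n" for u
    by auto
  have priv: "E p (?F p) \<and> (\<forall>u<n. ?F u < n \<and> E u (?F p) \<longrightarrow> u = p)" if "p < Suc j" "?F p < n" for p
  proof (cases "p = j")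
    case True
    then show ?thesis
      using t that(2) by (auto simp: selects_def)
  next
    case False
    then have "E p (F p) \<and> (\<forall>u<n. F u < n \<and> E u (F p) \<longrightarrow> u = p)"
      using F that by (simp add: partial_choice_def)
    then show ?thesis
      using shrink False by (simp add: fun_upd_other)
  qed
  have dom: "\<exists>w<n. ?F w < n \<and> E w v" if uv: "u < n" "v < n" "E u v" for u v
  proof -
    obtain w where w: "w < n" "F w < n" "E w v"
      using F uv unfolding partial_choice_def by blast
    show ?thesis
    proof (cases "w = j")
      case True
      show ?thesis
      proof (cases "t < n")
        case True
        then show ?thesis
          using w \<open>w = j\<close> by (intro exI[of _ j]) simp
      next
        case False
        then have "\<exists>u<n. (F(j := n)) u < n \<and> E u v"
          using t uv(2) w(3) \<open>w = j\<close> by (simp add: selects_def)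
        then show ?thesis
          unfolding other by blast
      qed
    next
      case False
      then show ?thesis
        using w by (intro exI[of _ w]) simp
    qed
  qed
  show ?thesis
    unfolding partial_choice_def
  proof (intro conjI)
    show "\<forall>p<n. ?F p \<le> n" "\<forall>p<n. Suc j \<le> p \<longrightarrow> ?F p < n"
      using F le by (auto simp: partial_choice_def)
  qed (use priv dom in blast)+
qed

lemma partial_choice_all:
  assumes "partial_choice n E n F"
  shows "private_choice n E F"
  using assms unfolding partial_choice_def by unfold_locales blast+

text \<open>The value n in \<open>t\<close> stands for an unsuccessful search, so the last store
  either confirms the tentative removal of \<open>p\<close> or puts \<open>p\<close> back into S
  together with its private out-neighbour.\<close>

definition choice_program :: com where
  "choice_program = FOR ''p'' (SEQ (STORE ''F'' (V ''p'') (V ''n'')) (SEQ (STORE ''t'' (Lit 0) (V ''n''))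
     (SEQ select_program (STORE ''F'' (V ''p'') (V ''t'')))))"

lemma runs_choice_program:
  assumes G: "stores_graph n E M" and F: "\<And>p. p < n \<Longrightarrow> M ''F'' p = 0"
  shows "runs choice_program M out (n * (n * (3 * n + 7) + 7) + 2)
    (\<lambda>M' out'. out' = out \<and> same_but {''b'', ''u'', ''v'', ''t'', ''p'', ''F''} M M' \<and>
       private_choice n E (M' ''F''))"
proof -
  let ?X = "{''b'', ''u'', ''v'', ''t'', ''p'', ''F''}"
  let ?I = "\<lambda>j M' out'. out' = out \<and> same_but ?X M M' \<and> partial_choice n E j (M' ''F'')"
  have "runs choice_program M out (n * (1 + (1 + ((n * (3 * n + 7) + 2) + 1)) + 2) + 2)
      (\<lambda>M' out'. out' = out \<and> same_but ?X M M' \<and> private_choice n E (M' ''F''))"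
    unfolding choice_program_def
  proof (rule runs_FOR[where n = n and I = ?I])
    fix j M1 out1
    assume j: "j < n" "M1 ''n'' 0 = n" "M1 ''p'' 0 = j" and I: "?I j M1 out1"
    let ?M = "(M1(''F'' := (M1 ''F'')(j := n)))(''t'' := (M1 ''t'')(0 := n))"
    have G1: "stores_graph n E ?M"
      using G by (rule stores_graph_cong) (use I in \<open>simp_all add: same_but_def\<close>)
    let ?Q = "\<lambda>M' out'. M' ''n'' 0 = n \<and> M' ''p'' 0 = j \<and> ?I (Suc j) (M'(''p'' := (M' ''p'')(0 := Suc j))) out'"
    have "runs (SEQ select_program (STORE ''F'' (V ''p'') (V ''t''))) ?M out1 ((n * (3 * n + 7) + 2) + 1) ?Q"
    proof (rule runs_SEQ, rule runs_select_program[OF G1])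
      fix M2 out2
      assume 2: "out2 = out1 \<and> same_but {''b'', ''u'', ''v'', ''t''} ?M M2 \<and>
         selects n E (?M ''F'') j n (M2 ''t'' 0)"
      have "partial_choice n E (Suc j) ((M1 ''F'')(j := M2 ''t'' 0))"
        using I 2 j(1) by (intro partial_choice_step) simp_all
      moreover have "M2 ''F'' = (M1 ''F'')(j := n)" "M2 ''p'' 0 = j"
        using 2 j by (simp_all add: same_but_def)
      ultimately have "partial_choice n E (Suc j) ((M2 ''F'')(M2 ''p'' 0 := M2 ''t'' 0))"
        by simp
      then show "runs (STORE ''F'' (V ''p'') (V ''t'')) M2 out2 1 ?Q"
        by (intro runs_STORE) (use I 2 j in \<open>auto simp: same_but_def\<close>)
    qed (use j in auto)
    then show "runs (SEQ (STORE ''F'' (V ''p'') (V ''n'')) (SEQ (STORE ''t'' (Lit 0) (V ''n''))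
        (SEQ select_program (STORE ''F'' (V ''p'') (V ''t''))))) M1 out1
        (1 + (1 + ((n * (3 * n + 7) + 2) + 1))) ?Q"
      by (intro runs_STORE_SEQ) (simp add: j)
  next
    fix M' out'
    assume "?I n M' out'"
    then show "out' = out \<and> same_but ?X M M' \<and> private_choice n E (M' ''F'')"
      using partial_choice_all by blast
  next
    \<comment> \<open>The zero-filled array already encodes S = V, because 0 < n whenever there is a
      vertex p < n.\<close>
    show "?I 0 (M(''p'' := (M ''p'')(0 := 0))) out"
      using F by (auto simp: partial_choice_def same_but_def)
  qed (use G in \<open>auto simp: stores_graph_def\<close>)
  then show ?thesis by (rule runs_mono) (auto simp: algebra_simps)
qed

text \<open>The entry of \<open>I\<close> with index \<open>n\<close> may be set as well; it is never read.\<close>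

definition mark_program :: com where
  "mark_program = FOR ''p'' (STORE ''I'' (Load ''F'' (V ''p'')) (Lit 1))"

lemma runs_mark_program:
  assumes "M ''n'' 0 = n" "\<And>i. M ''I'' i = 0" "private_choice n E (M ''F'')"
  shows "runs mark_program M out (3 * n + 2)
    (\<lambda>M' out'. out' = out \<and> same_but {''p'', ''I''} M M' \<and>
      (\<forall>i<n. M' ''I'' i = 0 \<longleftrightarrow> i \<notin> private_choice.chosen n (M ''F'')))"
proof -
  interpret private_choice n E "M ''F''" by fact
  let ?I = "\<lambda>j M' out'. out' = out \<and> same_but {''p'', ''I''} M M' \<and>
    (\<forall>i. M' ''I'' i = 0 \<longleftrightarrow> i \<notin> M ''F'' ` {..<j})"
  have "runs mark_program M out (n * (1 + 2) + 2)
     (\<lambda>M' out'. out' = out \<and> same_but {''p'', ''I''} M M' \<and> (\<forall>i<n. M' ''I'' i = 0 \<longleftrightarrow> i \<notin> chosen))"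
    unfolding mark_program_def
  proof (rule runs_FOR[where n = n and I = ?I])
    fix j M' out'
    assume j: "j < n" "M' ''n'' 0 = n" "M' ''p'' 0 = j" and I: "?I j M' out'"
    show "runs (STORE ''I'' (Load ''F'' (V ''p'')) (Lit 1)) M' out' 1
       (\<lambda>M' out'. M' ''n'' 0 = n \<and> M' ''p'' 0 = j \<and> ?I (Suc j) (M'(''p'' := (M' ''p'')(0 := Suc j))) out')"
      by (rule runs_STORE) (use j I in \<open>auto simp: same_but_def lessThan_Suc\<close>)
  next
    fix M' out'
    assume "?I n M' out'"
    then show "out' = out \<and> same_but {''p'', ''I''} M M' \<and> (\<forall>i<n. M' ''I'' i = 0 \<longleftrightarrow> i \<notin> chosen)"
      by (auto simp: chosen_def)
  qed (use assms in \<open>auto simp: same_but_def\<close>)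
  then show ?thesis by (rule runs_mono) auto
qed

section \<open>Writing the bags along the paths\<close>

definition bag_expr :: expr where
  "bag_expr = Add (Equal (Load ''F'' (V ''i'')) (V ''n'')) (Add (Equal (Load ''I'' (V ''i'')) (Lit 0))
     (Add (Equal (V ''i'') (V ''y'')) (Equal (V ''i'') (Load ''F'' (V ''y'')))))"

definition bag_program :: com where
  "bag_program = SEQ (FOR ''i'' (IF bag_expr (EMIT (Add (V ''i'') (Lit 1))) SKIP)) (EMIT (Lit 0))"

definition encode_bag :: "nat list \<Rightarrow> nat list" where
  "encode_bag b = map Suc b @ [0]"

lemma runs_bag_program:
  assumes P: "private_choice n E F" and M: "M ''n'' 0 = n" "M ''F'' = F" "M ''y'' 0 = y"
    and I: "\<forall>i<n. M ''I'' i = 0 \<longleftrightarrow> i \<notin> private_choice.chosen n F"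
  shows "runs bag_program M out (4 * n + 3)
    (\<lambda>M' out'. out' = out @ encode_bag (private_choice.bag n F y) \<and> same_but {''i''} M M')"
proof -
  interpret private_choice n E F by fact
  let ?P = "\<lambda>i. F i = n \<or> i \<notin> chosen \<or> i = y \<or> i = F y"
  let ?I = "\<lambda>j M' out'. out' = out @ map Suc (filter ?P [0..<j]) \<and> same_but {''i''} M M'"
  have "runs bag_program M out (n * (1 + 1 + 2) + 2 + 1)
    (\<lambda>M' out'. out' = out @ encode_bag (bag y) \<and> same_but {''i''} M M')"
    unfolding bag_program_def
  proof (rule runs_SEQ, rule runs_FOR[where n = n and I = ?I and Q = "?I n"])
    fix j M' out'
    assume j: "j < n" "M' ''n'' 0 = n" "M' ''i'' 0 = j" and J: "?I j M' out'"
    \<comment> \<open>A sum of truth values acts as a disjunction: it is nonzero exactly if one of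
      them is 1.\<close>
    have "eval M' bag_expr \<noteq> 0 \<longleftrightarrow> ?P j"
      using J M I j by (auto simp: bag_expr_def same_but_def)
    then show "runs (IF bag_expr (EMIT (Add (V ''i'') (Lit 1))) SKIP) M' out' (1 + 1)
       (\<lambda>M' out'. M' ''n'' 0 = n \<and> M' ''i'' 0 = j \<and> ?I (Suc j) (M'(''i'' := (M' ''i'')(0 := Suc j))) out')"
      by (intro runs_IF runs_EMIT runs_SKIP) (use j J in \<open>auto simp: same_but_def\<close>)
  next
    fix M' out'
    assume "?I n M' out'"
    then show "runs (EMIT (Lit 0)) M' out' 1
      (\<lambda>M' out'. out' = out @ encode_bag (bag y) \<and> same_but {''i''} M M')"
      by (intro runs_EMIT) (auto simp: encode_bag_def bag_def)
  qed (use M in \<open>auto simp: same_but_def\<close>)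
  then show ?thesis by (rule runs_mono) auto
qed

text \<open>Paths start at the unmarked vertices, those outside F(S). A path ends when
  \<open>F\<close> yields n, which also falsifies the guard of the inner loop.\<close>

definition walk_program :: com where
  "walk_program = FOR ''x'' (IF (Equal (Load ''I'' (V ''x'')) (Lit 0))
     (SEQ (STORE ''y'' (Lit 0) (V ''x''))
       (WHILE (Less (V ''y'') (V ''n'')) (SEQ bag_program (STORE ''y'' (Lit 0) (Load ''F'' (V ''y''))))))
     SKIP)"

context private_choice
begin

lemma length_walks: "walks ys \<Longrightarrow> length ys \<le> n"
  using card_mono[of "{..<n}" "set ys"] by (simp add: walks_def distinct_card)

definition encode_bags :: "nat list \<Rightarrow> nat list" where
  "encode_bags ys = concat (map (\<lambda>y. encode_bag (bag y)) ys)"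

text \<open>The list \<open>zs\<close> extends complete walks \<open>ys\<close> by an initial piece of the walk from \<open>x\<close>.\<close>

definition extends :: "nat list \<Rightarrow> nat \<Rightarrow> nat list \<Rightarrow> bool" where
  "extends ys x zs \<longleftrightarrow> walks zs \<and> insert x (set ys) \<subseteq> set zs \<and>
     (\<forall>z\<in>set zs. z \<notin> chosen \<longrightarrow> z \<in> insert x (set ys))"

lemma extends_start:
  assumes "walks ys" "ended ys" "x < n" "x \<notin> chosen" "x \<notin> set ys"
  shows "extends ys x (ys @ [x])"
  using walks_start[OF assms(1,2,3,5,4)] by (auto simp: extends_def)

lemma extends_step:
  assumes "extends ys x (zs @ [y])" "F y < n"
  shows "extends ys x ((zs @ [y]) @ [F y])"
proof -
  have w: "walks (zs @ [y])"
    using assms(1) by (simp add: extends_def)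
  then have "y < n"
    using walksD(2)[OF w] by simp
  then have "F y \<in> chosen"
    using assms(2) by (auto simp: chosen_def)
  then show ?thesis
    using walks_step[OF w assms(2)] assms(1) by (auto simp: extends_def)
qed

lemma runs_walk_loop:
  assumes M: "M ''n'' 0 = n" "M ''F'' = F" "M ''y'' 0 = x"
    and I: "\<forall>i<n. M ''I'' i = 0 \<longleftrightarrow> i \<notin> chosen"
    and ys: "walks ys" "ended ys" "x < n" "x \<notin> chosen" "x \<notin> set ys"
  shows "runs (WHILE (Less (V ''y'') (V ''n'')) (SEQ bag_program (STORE ''y'' (Lit 0) (Load ''F'' (V ''y'')))))
     M (encode_bags ys) (n * (4 * n + 5) + 1)
     (\<lambda>M' out'. same_but {''i'', ''y''} M M' \<and>
        (\<exists>zs. out' = encode_bags zs \<and> extends ys x zs \<and> ended zs))" (is "runs ?W _ _ _ ?Q")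
proof -
  \<comment> \<open>The bags of \<open>zs\<close> have been written and that of the current vertex
    is pending; the rounds allowed are the n - \<open>length zs\<close> positions still free in a
    list without repetitions.\<close>
  let ?J = "\<lambda>m M' out'. same_but {''i'', ''y''} M M' \<and>
      (\<exists>zs. out' = encode_bags zs \<and> length zs + m = n \<and>
        (M' ''y'' 0 < n \<and> extends ys x (zs @ [M' ''y'' 0]) \<or>
         M' ''y'' 0 = n \<and> extends ys x zs \<and> ended zs))"
  have "runs ?W M (encode_bags ys) ((n - length ys) * (4 * n + 3 + 1 + 1) + 1) ?Q"
  proof (rule runs_WHILE[where I = ?J])
    show "?J (n - length ys) M (encode_bags ys)"
      using M(3) length_walks[OF ys(1)] extends_start[OF ys] ys(3) by (auto simp: same_but_def)
  next
    fix M' out'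
    assume J: "?J 0 M' out'"
    then obtain zs where zs: "length zs = n"
      "M' ''y'' 0 < n \<and> extends ys x (zs @ [M' ''y'' 0]) \<or> M' ''y'' 0 = n"
      by auto
    \<comment> \<open>A list of n distinct vertices cannot be prolonged, so with no rounds left the
      pending value must be n.\<close>
    have "\<not> extends ys x (zs @ [M' ''y'' 0])"
      using length_walks[of "zs @ [M' ''y'' 0]"] zs(1) by (auto simp: extends_def)
    then show "eval M' (Less (V ''y'') (V ''n'')) = 0"
      using zs(2) J M(1) by (auto simp: same_but_def)
  next
    fix m M1 out1
    assume J: "?J (Suc m) M1 out1" and "eval M1 (Less (V ''y'') (V ''n'')) \<noteq> 0"
    define y where "y = M1 ''y'' 0"
    have M1: "M1 ''n'' 0 = n" "M1 ''F'' = F" "M1 ''I'' = M ''I''"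
      using J M by (simp_all add: same_but_def)
    then have "y < n"
      using \<open>eval M1 _ \<noteq> 0\<close> by (simp add: y_def split: if_splits)
    then obtain zs where zs: "out1 = encode_bags zs" "length zs + Suc m = n" "extends ys x (zs @ [y])"
      using J by (auto simp: y_def)
    show "runs (SEQ bag_program (STORE ''y'' (Lit 0) (Load ''F'' (V ''y'')))) M1 out1 (4 * n + 3 + 1) (?J m)"
    proof (rule runs_SEQ, rule runs_bag_program[OF private_choice_axioms M1(1,2)])
      show "M1 ''y'' 0 = y" by (simp add: y_def)
      show "\<forall>i<n. M1 ''I'' i = 0 \<longleftrightarrow> i \<notin> chosen" using I M1(3) by simp
      fix M2 out2
      assume 2: "out2 = out1 @ encode_bag (bag y) \<and> same_but {''i''} M1 M2"
      have e: "out2 = encode_bags (zs @ [y])"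
        using 2 zs(1) by (simp add: encode_bags_def)
      have "F y < n \<and> extends ys x ((zs @ [y]) @ [F y]) \<or> F y = n \<and> extends ys x (zs @ [y]) \<and> ended (zs @ [y])"
        using F_le[OF \<open>y < n\<close>] extends_step[OF zs(3)] zs(3) by (auto simp: ended_def)
      moreover have "M2 ''F'' = F" "M2 ''y'' 0 = y"
        using 2 M1 by (simp_all add: same_but_def y_def)
      moreover have "same_but {''i'', ''y''} M (M2(''y'' := (M2 ''y'')(0 := F y)))"
        using J 2 by (simp add: same_but_def)
      ultimately show "runs (STORE ''y'' (Lit 0) (Load ''F'' (V ''y''))) M2 out2 1 (?J m)"
        using e zs(2) by (intro runs_STORE conjI exI[of _ "zs @ [y]"]) simp_all
    qed
  next
    fix m M' out'
    assume "?J m M' out'" "eval M' (Less (V ''y'') (V ''n'')) = 0"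
    then show "?Q M' out'"
      using M(1) by (auto simp: same_but_def split: if_splits)
  qed
  then show ?thesis
    by (rule runs_mono) (auto intro!: mult_le_mono)
qed

lemma runs_walk_program:
  assumes M: "M ''n'' 0 = n" "M ''F'' = F" and I: "\<forall>i<n. M ''I'' i = 0 \<longleftrightarrow> i \<notin> chosen"
  shows "runs walk_program M [] (n * (n * (4 * n + 5) + 5) + 2)
     (\<lambda>M' out'. \<exists>ys. out' = encode_bags ys \<and> walks ys \<and> ended ys \<and> (\<forall>x<n. x \<notin> chosen \<longrightarrow> x \<in> set ys))"
    (is "runs _ _ _ _ ?Q")
proof -
  \<comment> \<open>The last conjunct ensures that the next starting vertex j is not yet on the
    list.\<close>
  let ?J = "\<lambda>j M' out'. same_but {''i'', ''y'', ''x''} M M' \<and>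
     (\<exists>ys. out' = encode_bags ys \<and> walks ys \<and> ended ys \<and> (\<forall>x<j. x \<notin> chosen \<longrightarrow> x \<in> set ys) \<and>
       (\<forall>z\<in>set ys. z \<notin> chosen \<longrightarrow> z < j))"
  \<comment> \<open>A crude count: n bags are allowed for each start, although all paths together
    have at most n vertices.\<close>
  have "runs walk_program M [] (n * (1 + (n * (4 * n + 5) + 1) + 1 + 2) + 2) ?Q"
    unfolding walk_program_def
  proof (rule runs_FOR[where n = n and I = ?J])
    fix j M1 out1
    assume j: "j < n" "M1 ''n'' 0 = n" "M1 ''x'' 0 = j" and J: "?J j M1 out1"
    let ?Q1 = "\<lambda>M' out'. M' ''n'' 0 = n \<and> M' ''x'' 0 = j \<and> ?J (Suc j) (M'(''x'' := (M' ''x'')(0 := Suc j))) out'"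
    have M1: "M1 ''F'' = F" "M1 ''I'' = M ''I''" and same: "same_but {''i'', ''y'', ''x''} M M1"
      using J M by (simp_all add: same_but_def)
    obtain ys where ys: "out1 = encode_bags ys" "walks ys" "ended ys"
       "\<forall>x<j. x \<notin> chosen \<longrightarrow> x \<in> set ys" "\<forall>z\<in>set ys. z \<notin> chosen \<longrightarrow> z < j"
      using J by blast
    have mark: "eval M1 (Equal (Load ''I'' (V ''x'')) (Lit 0)) \<noteq> 0 \<longleftrightarrow> j \<notin> chosen"
      using I j M1 by auto
    show "runs (IF (Equal (Load ''I'' (V ''x'')) (Lit 0))
     (SEQ (STORE ''y'' (Lit 0) (V ''x''))
       (WHILE (Less (V ''y'') (V ''n'')) (SEQ bag_program (STORE ''y'' (Lit 0) (Load ''F'' (V ''y''))))))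
     SKIP) M1 out1 (1 + (n * (4 * n + 5) + 1) + 1) ?Q1"
    proof (rule runs_IF)
      assume "eval M1 (Equal (Load ''I'' (V ''x'')) (Lit 0)) \<noteq> 0"
      then have "j \<notin> chosen" using mark by blast
      moreover from this have "j \<notin> set ys" using ys(5) by blast
      ultimately have "runs (WHILE (Less (V ''y'') (V ''n''))
          (SEQ bag_program (STORE ''y'' (Lit 0) (Load ''F'' (V ''y'')))))
          (M1(''y'' := (M1 ''y'')(0 := j))) out1 (n * (4 * n + 5) + 1)
          (\<lambda>M' out'. same_but {''i'', ''y''} (M1(''y'' := (M1 ''y'')(0 := j))) M' \<and>
            (\<exists>zs. out' = encode_bags zs \<and> extends ys j zs \<and> ended zs))"
        unfolding ys(1) using j M1 I ys(2,3) by (intro runs_walk_loop) simp_all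
      then have "runs (WHILE (Less (V ''y'') (V ''n''))
          (SEQ bag_program (STORE ''y'' (Lit 0) (Load ''F'' (V ''y'')))))
          (M1(''y'' := (M1 ''y'')(0 := j))) out1 (n * (4 * n + 5) + 1) ?Q1"
      proof (rule runs_mono)
        fix M' out'
        assume *: "same_but {''i'', ''y''} (M1(''y'' := (M1 ''y'')(0 := j))) M' \<and>
            (\<exists>zs. out' = encode_bags zs \<and> extends ys j zs \<and> ended zs)"
        then obtain zs where zs: "out' = encode_bags zs" "extends ys j zs" "ended zs"
          by blast
        have "walks zs" "\<forall>x<Suc j. x \<notin> chosen \<longrightarrow> x \<in> set zs" "\<forall>z\<in>set zs. z \<notin> chosen \<longrightarrow> z < Suc j"
          using zs(2) ys(4,5) unfolding extends_def by (auto simp: less_Suc_eq)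
        moreover have "M' ''n'' 0 = n" "M' ''x'' 0 = j"
          "same_but {''i'', ''y'', ''x''} M (M'(''x'' := (M' ''x'')(0 := Suc j)))"
          using * j same by (simp_all add: same_but_def)
        ultimately show "?Q1 M' out'"
          using zs(1,3) by blast
      qed simp
      then show "runs (SEQ (STORE ''y'' (Lit 0) (V ''x''))
         (WHILE (Less (V ''y'') (V ''n'')) (SEQ bag_program (STORE ''y'' (Lit 0) (Load ''F'' (V ''y''))))))
         M1 out1 (1 + (n * (4 * n + 5) + 1)) ?Q1"
        by (intro runs_STORE_SEQ) (simp add: j)
    next
      assume "eval M1 (Equal (Load ''I'' (V ''x'')) (Lit 0)) = 0"
      then have "j \<in> chosen" using mark by blast
      then have "\<forall>x<Suc j. x \<notin> chosen \<longrightarrow> x \<in> set ys" "\<forall>z\<in>set ys. z \<notin> chosen \<longrightarrow> z < Suc j"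
        using ys(4,5) by (auto simp: less_Suc_eq)
      moreover have "same_but {''i'', ''y'', ''x''} M (M1(''x'' := (M1 ''x'')(0 := Suc j)))"
        using same by (simp add: same_but_def)
      ultimately have Q1: "?Q1 M1 out1"
        using j ys(1-3) by blast
      show "runs SKIP M1 out1 (1 + (n * (4 * n + 5) + 1)) ?Q1"
        by (rule runs_SKIP[where Q = ?Q1, OF Q1]) simp
    qed
  next
    have "same_but {''i'', ''y'', ''x''} M (M(''x'' := (M ''x'')(0 := 0)))"
      by (simp add: same_but_def)
    moreover have "[] = encode_bags []" by (simp add: encode_bags_def)
    ultimately show "?J 0 (M(''x'' := (M ''x'')(0 := 0))) []"
      using walks_Nil ended_Nil by auto
  next
    fix M' out'
    assume "?J n M' out'"
    then show "?Q M' out'" by blast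
  qed (use M(1) in simp_all)
  then show ?thesis by (rule runs_mono) (auto simp: algebra_simps)
qed

end

definition decomposition_program :: com where
  "decomposition_program = SEQ row_program (SEQ choice_program (SEQ mark_program walk_program))"

text \<open>Occurrence in \<open>ys\<close> is claimed only for the starting vertices outside F(S).
  That the others occur follows from the rank, which is unknown to the program.\<close>

lemma runs_decomposition_program:
  assumes M: "M ''n'' 0 = n" "\<forall>u<n. \<forall>v<n. M ''A'' (u * n + v) = of_bool (E u v)"
    and zero: "\<And>x a. x \<in> {''R'', ''F'', ''I''} \<Longrightarrow> M x a = 0"
  shows "runs decomposition_program M [] (7 * n ^ 3 + 12 * n ^ 2 + 18 * n + 8)
    (\<lambda>M' out'. \<exists>F ys. private_choice n E F \<and> out' = private_choice.encode_bags n F ys \<and>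
       private_choice.walks n F ys \<and> private_choice.ended n F ys \<and>
       (\<forall>x<n. x \<notin> private_choice.chosen n F \<longrightarrow> x \<in> set ys))" (is "runs _ _ _ _ ?Q")
proof -
  have "runs decomposition_program M [] ((3 * n + 2) + ((n * (n * (3 * n + 7) + 7) + 2) +
      ((3 * n + 2) + (n * (n * (4 * n + 5) + 5) + 2)))) ?Q"
    unfolding decomposition_program_def
  proof (rule runs_SEQ, rule runs_row_program)
    fix M1 and out1 :: "nat list"
    assume 1: "out1 = [] \<and> same_but {''i'', ''R''} M M1 \<and> (\<forall>i\<le>n. M1 ''R'' i = i * n)"
    have G: "stores_graph n E M1"
      using M 1 by (simp add: stores_graph_def same_but_def)
    have M1: "M1 ''F'' a = 0" "M1 ''I'' a = 0" "M1 ''n'' 0 = n" for a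
      using 1 M zero by (simp_all add: same_but_def)
    show "runs (SEQ choice_program (SEQ mark_program walk_program)) M1 out1
      ((n * (n * (3 * n + 7) + 7) + 2) + ((3 * n + 2) + (n * (n * (4 * n + 5) + 5) + 2))) ?Q"
    proof (rule runs_SEQ, rule runs_choice_program[OF G M1(1)])
      fix M2 out2
      assume 2: "out2 = out1 \<and> same_but {''b'', ''u'', ''v'', ''t'', ''p'', ''F''} M1 M2 \<and>
        private_choice n E (M2 ''F'')"
      then interpret private_choice n E "M2 ''F''" by blast
      have M2: "M2 ''I'' i = 0" "M2 ''n'' 0 = n" for i
        using 2 M1 by (simp_all add: same_but_def)
      show "runs (SEQ mark_program walk_program) M2 out2
        ((3 * n + 2) + (n * (n * (4 * n + 5) + 5) + 2)) ?Q"
      proof (rule runs_SEQ, rule runs_mark_program[OF M2(2,1) private_choice_axioms])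
        fix M3 out3
        assume 3: "out3 = out2 \<and> same_but {''p'', ''I''} M2 M3 \<and>
          (\<forall>i<n. M3 ''I'' i = 0 \<longleftrightarrow> i \<notin> chosen)"
        have "M3 ''n'' 0 = n" "M3 ''F'' = M2 ''F''" "\<forall>i<n. M3 ''I'' i = 0 \<longleftrightarrow> i \<notin> chosen" "out3 = []"
          using 1 2 3 M2 by (simp_all add: same_but_def)
        then have "runs walk_program M3 out3 (n * (n * (4 * n + 5) + 5) + 2)
           (\<lambda>M' out'. \<exists>ys. out' = encode_bags ys \<and> walks ys \<and> ended ys \<and>
              (\<forall>x<n. x \<notin> chosen \<longrightarrow> x \<in> set ys))"
          using runs_walk_program by simp
        then show "runs walk_program M3 out3 (n * (n * (4 * n + 5) + 5) + 2) ?Q"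
          by (rule runs_mono) (use private_choice_axioms in blast)+
      qed
    qed
  qed (use M zero in auto)
  then show ?thesis
    by (rule runs_mono) (auto simp: algebra_simps power2_eq_square power3_eq_cube)
qed

section \<open>Leaves and pathwidth\<close>

lemma encodes_bags_map:
  assumes "private_choice (length vs) E F"
  shows "encodes_bags vs (private_choice.encode_bags (length vs) F ys)
     (map (\<lambda>y. (!) vs ` set (private_choice.bag (length vs) F y)) ys)"
proof -
  interpret private_choice "length vs" E F by fact
  show ?thesis
    unfolding encodes_bags_def
    by (rule exI[of _ "map bag ys"]) (auto simp: encode_bags_def encode_bag_def bag_def o_def)
qed

lemma input_memory_arc:
  assumes "u < length vs" "v < length vs"
  shows "input_memory k D vs ''A'' (u * length vs + v) = of_bool ((vs ! u, vs ! v) \<in> arcs_ends D)"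
proof -
  have "u * length vs + v < Suc u * length vs"
    using assms(2) by simp
  also have "\<dots> \<le> length vs * length vs"
    using assms(1) by (intro mult_le_mono1) simp
  finally have "u * length vs + v < length vs * length vs" .
  moreover have "(u * length vs + v) div length vs = u"
    using assms(2) by (subst div_mult_self3) auto
  ultimately show ?thesis
    using assms by (simp add: input_memory_def Let_def)
qed

lemma decomposition_program_correct:
  fixes D :: "('a, 'b) pre_digraph"
  assumes D: "digraph D" "acyclic_digraph D"
    and s: "\<exists>!s. s \<in> verts D \<and> in_degree D s = 0"
    and vs: "distinct vs" "set vs = verts D"
  shows "\<exists>t M out Xs. exec decomposition_program (input_memory k D vs, []) t (M, out) \<and>
     t \<le> 7 * length vs ^ 3 + 12 * length vs ^ 2 + 18 * length vs + 8 \<and>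
     encodes_bags vs out Xs \<and> path_decomposition (UG D) Xs \<and>
     width Xs \<le> 2 * int (max_leaves D) + 1"
proof -
  interpret digraph D by fact
  let ?n = "length vs"
  let ?E = "\<lambda>i j. (vs ! i, vs ! j) \<in> arcs_ends D"
  obtain r :: "'a \<Rightarrow> nat" where r: "\<And>u v. (u, v) \<in> arcs_ends D \<Longrightarrow> r u < r v"
    using acyclic_digraph_rank[OF D] by blast
  obtain s where s: "s \<in> verts D" "in_degree D s = 0"
    and unique: "\<And>v. v \<in> verts D \<Longrightarrow> in_degree D v = 0 \<Longrightarrow> v = s"
    using s by blast
  have "runs decomposition_program (input_memory k D vs) []
    (7 * ?n ^ 3 + 12 * ?n ^ 2 + 18 * ?n + 8)
    (\<lambda>M' out'. \<exists>F ys. private_choice ?n ?E F \<and> out' = private_choice.encode_bags ?n F ys \<and>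
       private_choice.walks ?n F ys \<and> private_choice.ended ?n F ys \<and>
       (\<forall>x<?n. x \<notin> private_choice.chosen ?n F \<longrightarrow> x \<in> set ys))"
    by (rule runs_decomposition_program) (auto simp: input_memory_arc, auto simp: input_memory_def Let_def)
  then obtain t M F ys where exec: "exec decomposition_program (input_memory k D vs, []) t
        (M, private_choice.encode_bags ?n F ys)"
      "t \<le> 7 * ?n ^ 3 + 12 * ?n ^ 2 + 18 * ?n + 8"
    and F: "private_choice ?n ?E F"
    and ys: "private_choice.walks ?n F ys" "private_choice.ended ?n F ys"
      "\<forall>x<?n. x \<notin> private_choice.chosen ?n F \<longrightarrow> x \<in> set ys"
    unfolding runs_def by blast
  interpret private_choice ?n ?E F by fact
  have set_ys: "set ys = {..<?n}"
    using walks_exhaustive[of "\<lambda>i. r (vs ! i)", OF _ ys(1,2)] r ys(3) by blast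
  have "?n > 0"
    using s(1) vs(2) by (cases vs) auto
  then have "0 \<in> set ys"
    unfolding set_ys by simp
  then have "ys \<noteq> []"
    by (cases ys) simp_all
  \<comment> \<open>By uniqueness of the source every other vertex has an in-neighbour, hence by
    \<open>dominated\<close> one in S, and the leaf bound applies to the complement of S.\<close>
  have "card {i. i < ?n \<and> F i = ?n} \<le> max_leaves D"
  proof -
    let ?S = "(!) vs ` {i. i < ?n \<and> F i < ?n}"
    have "\<exists>u\<in>?S. (u, v) \<in> arcs_ends D" if "v \<in> verts D" "v \<noteq> s" for v
    proof -
      have "in_arcs D v \<noteq> {}"
        using unique[OF that(1)] that(2) by (auto simp: in_degree_def)
      then obtain a where "a \<in> in_arcs D v"
        by blast
      then have "(tail D a, v) \<in> arcs_ends D"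
        using in_arcs_imp_in_arcs_ends[of a] by auto
      then obtain u where uv: "(u, v) \<in> arcs_ends D" ..
      obtain i j where "i < ?n" "u = vs ! i" "j < ?n" "v = vs ! j"
        using adj_in_verts[OF uv] unfolding vs(2)[symmetric] in_set_conv_nth by blast
      then show ?thesis
        using dominated[of i j] uv by auto
    qed
    then have "card (verts D - ?S) \<le> max_leaves D"
      by (rule card_diff_dominating_le_max_leaves[OF D s])
    moreover have "verts D - ?S = (!) vs ` {i. i < ?n \<and> F i = ?n}"
    proof -
      have "verts D = (!) vs ` {..<?n}"
        using vs(2) by (auto simp: set_conv_nth)
      moreover have "inj_on ((!) vs) {..<?n}"
        using vs(1) by (intro inj_on_nth) auto
      ultimately have "verts D - ?S = (!) vs ` ({..<?n} - {i. i < ?n \<and> F i < ?n})"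
        by (simp add: inj_on_image_set_diff[of _ "{..<?n}"] subset_eq)
      moreover have "{..<?n} - {i. i < ?n \<and> F i < ?n} = {i. i < ?n \<and> F i = ?n}"
        using F_le by (auto simp: le_less)
      ultimately show ?thesis by simp
    qed
    moreover have "card ((!) vs ` {i. i < ?n \<and> F i = ?n}) = card {i. i < ?n \<and> F i = ?n}"
      using vs(1) by (intro card_image inj_on_nth) auto
    ultimately show ?thesis by simp
  qed
  then have "width (map (\<lambda>y. (!) vs ` set (bag y)) ys) \<le> 2 * int (max_leaves D) + 1"
    using width_bags_le[OF F \<open>ys \<noteq> []\<close>] by linarith
  moreover have "path_decomposition (UG D) (map (\<lambda>y. (!) vs ` set (bag y)) ys)"
    using path_decomposition_bags[OF wf_digraph vs _ F ys(1,2) set_ys] s(1) by blast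
  ultimately show ?thesis
    using exec encodes_bags_map[OF F] by blast
qed

lemma pathwidth_le_width:
  assumes "finite (verts G)" "path_decomposition G Xs"
  shows "pathwidth G \<le> width Xs"
proof -
  have "bdd_below {width Xs | Xs. path_decomposition G Xs}"
    by (rule bdd_belowI[of _ "-1"]) (auto simp: width_def)
  then show ?thesis
    unfolding pathwidth_def using assms(2) by (intro cInf_lower) auto
qed

theorem theorem7:
  shows "\<exists>(algo :: com) (p :: nat poly). \<forall>(k :: nat) (D :: ('a,'b) pre_digraph).
    k \<ge> 1 \<longrightarrow> digraph D \<longrightarrow> acyclic_digraph D \<longrightarrow>
    (\<exists>!s. s \<in> verts D \<and> in_degree D s = 0) \<longrightarrow>
      max_leaves D \<ge> k \<or>
      (pathwidth (UG D) \<le> 4 * int k \<and>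
       (\<forall>vs. distinct vs \<and> set vs = verts D \<longrightarrow>
          (\<exists>t M out Xs. exec algo (input_memory k D vs, []) t (M, out) \<and>
             t \<le> poly p (length vs) \<and>
             encodes_bags vs out Xs \<and>
             path_decomposition (UG D) Xs \<and> width Xs \<le> 4 * int k)))"
proof (intro exI allI impI)
  fix k :: nat and D :: "('a,'b) pre_digraph"
  assume D: "digraph D" "acyclic_digraph D" "\<exists>!s. s \<in> verts D \<and> in_degree D s = 0"
  let ?p = "[:8, 18, 12, 7:] :: nat poly"
  have time: "poly ?p n = 7 * n ^ 3 + 12 * n ^ 2 + 18 * n + 8" for n
    by (simp add: algebra_simps power2_eq_square power3_eq_cube)
  show "max_leaves D \<ge> k \<or>
      (pathwidth (UG D) \<le> 4 * int k \<and>
       (\<forall>vs. distinct vs \<and> set vs = verts D \<longrightarrow>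
          (\<exists>t M out Xs. exec decomposition_program (input_memory k D vs, []) t (M, out) \<and>
             t \<le> poly ?p (length vs) \<and>
             encodes_bags vs out Xs \<and>
             path_decomposition (UG D) Xs \<and> width Xs \<le> 4 * int k)))"
  proof (cases "max_leaves D \<ge> k")
    case False
    \<comment> \<open>From \<open>max_leaves D\<close> \<le> k - 1 the left side is at most 2 k -
      1.\<close>
    then have le: "2 * int (max_leaves D) + 1 \<le> 4 * int k"
      by simp
    have alg: "\<exists>t M out Xs. exec decomposition_program (input_memory k D vs, []) t (M, out) \<and>
             t \<le> poly ?p (length vs) \<and>
             encodes_bags vs out Xs \<and>
             path_decomposition (UG D) Xs \<and> width Xs \<le> 4 * int k"
      if "distinct vs \<and> set vs = verts D" for vs
      using decomposition_program_correct[OF D, of vs k] that le order_trans unfolding time by blast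
    have fin: "finite (verts D)"
      using D(1) by (simp add: digraph_def fin_digraph.finite_verts)
    then obtain vs where "set vs = verts D \<and> distinct vs"
      using finite_distinct_list by blast
    then obtain Xs where "path_decomposition (UG D) Xs" "width Xs \<le> 4 * int k"
      using alg[of vs] by blast
    then have "pathwidth (UG D) \<le> 4 * int k"
      using pathwidth_le_width[of "UG D" Xs] fin by simp
    then show ?thesis
      using alg by blast
  qed simp
qed

end
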